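(* Let $n\ge 2$, $1\le r\le n-1$, and let $A,\Delta A\in\mathbb{C}^{n\times n}$, $\widetilde A:=A+\Delta A$. Assume $A$ and $\widetilde A$ are diagonalizable, with eigendecompositions $$A[X_1,X_2]=[X_1,X_2]\begin{pmatrix}\Lambda_1&0\\0&\Lambda_2\end{pmatrix},\qquad \widetilde A[\widetilde X_1,\widetilde X_2]=[\widetilde X_1,\widetilde X_2]\begin{pmatrix}\widetilde\Lambda_1&0\\0&\widetilde\Lambda_2\end{pmatrix},$$ where $X=[X_1,X_2]$ and $\widetilde X=[\widetilde X_1,\widetilde X_2]$ are invertible $n\times n$ complex matrices, the columns of $X$ have unit $\ell_2$-norm, $X_1,\widetilde X_1\in\mathbb{C}^{n\times r}$, and $\Lambda_1,\widetilde\Lambda_1\in\mathbb{C}^{r\times r}$, $\Lambda_2,\widetilde\Lambda_2\in\mathbb{C}^{(n-r)\times(n-r)}$ are diagonal (so $r$ is the number of eigenvalues in $\Lambda_1$). Let $\widetilde\lambda_1,\dots,\widetilde\lambda_r$ be the diagonal entries of $\widetilde\Lambda_1$, let $S(\cdot)$ denote the spectrum of a matrix, and assume $$\delta_\lambda:=\min_{\lambda\in S(\widetilde\Lambda_1),\ \sigma\in S(\Lambda_2)}|\lambda-\sigma|>0.$$ Write $(X^{-1})^*=[V_1,V_2]$ with $V_2\in\mathbb{C}^{n\times(n-r)}$, and set $a:=\|A\|+\|\Delta A\|+\rho(\Lambda_2)$, where $\rho(\Lambda_2)$ is the spectral radius of $\Lambda_2$. Let $Q_{X_1}$ and $Q_{\widetilde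 X_1}$ be $n\times r$ matrices with orthonormal columns spanning the column spaces of $X_1$ and $\widetilde X_1$, respectively (the $Q$-factors of the thin QR decompositions). Then $$\left\|\sin\Theta(Q_{X_1},Q_{\widetilde X_1})\right\|\le\frac{\kappa_2(V_2)\,\|\Delta A\|_F}{a}\prod_{j=1}^r\left(1+\frac{a}{\min_{\lambda_k\in S(\Lambda_2)}|\widetilde\lambda_j-\lambda_k|}\right)\le\frac{\kappa_2(V_2)\,\|\Delta A\|_F}{a}\prod_{j=1}^r\left(1+\frac{a}{\delta_\lambda}\right).$$
   Context: $\|\cdot\|$ is the $\ell_2$-norm of vectors and the spectral norm of matrices; $\|\cdot\|_F$ is the Frobenius norm; $^*$ is the conjugate transpose. $\kappa_2(Z)=\sigma_{\max}(Z)/\sigma_{\min}(Z)$ is the ratio of the largest to the smallest singular value of a (possibly rectangular, full column rank) matrix $Z$. For $Q,\widetilde Q\in\mathbb{C}^{n\times r}$ with orthonormal columns, let $\zeta_1\ge\dots\ge\zeta_r\ge 0$ be the singular values of $Q^*\widetilde Q$; then $\sin\Theta(Q,\widetilde Q):=\mathrm{diag}\{\sin(\cos^{-1}\zeta_1),\dots,\sin(\cos^{-1}\zeta_r)\}$. Its spectral norm depends only on the column spaces of $Q$ and $\widetilde Q$. *)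

theory Defs
  imports
    "HOL-Computational_Algebra.Polynomial"
    "Jordan_Normal_Form.Schur_Decomposition"
    "Jordan_Normal_Form.VS_Connect"
    "Jordan_Normal_Form.Spectral_Radius"
begin

definition l2_norm :: "complex vec \<Rightarrow> real" where
  "l2_norm v = sqrt (\<Sum>i<dim_vec v. (cmod (v $ i))\<^sup>2)"

definition frobenius_norm :: "complex mat \<Rightarrow> real" where
  "frobenius_norm A = sqrt (\<Sum>i<dim_row A. \<Sum>j<dim_col A. (cmod (A $$ (i, j)))\<^sup>2)"

definition append_cols :: "complex mat \<Rightarrow> complex mat \<Rightarrow> complex mat" where
  "append_cols A B = mat_of_cols (dim_row A) (cols A @ cols B)"

definition block_diag :: "complex mat \<Rightarrow> complex mat \<Rightarrow> complex mat" where
  "block_diag A B =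
     four_block_mat A (0\<^sub>m (dim_row A) (dim_col B)) (0\<^sub>m (dim_row B) (dim_col A)) B"

text \<open>The square roots of the eigenvalues of \<open>A\<^sup>* A\<close>, repeated by algebraic multiplicity and
  listed in decreasing order. These eigenvalues are real and nonnegative, so taking the real part
  loses nothing. The list has \<open>dim_col A\<close> entries; for a matrix with more columns than rows it
  therefore contains additional zeros compared with the convention of \<open>min (dim_row A) (dim_col A)\<close>
  singular values, which coincides with this one for matrices with at least as many rows
  as columns.\<close>

definition singular_values :: "complex mat \<Rightarrow> real list" where
  "singular_values A =
     rev (sorted_list_of_multiset
       (image_mset (\<lambda>z. sqrt (Re z)) (proots (char_poly (mat_adjoint A * A)))))"

text \<open>Since \<open>Max {}\<close> is unspecified, the next two notions are meaningful only for matrices with at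
  least one column, and \<open>kappa2\<close> only for matrices of full column rank.\<close>

definition spectral_norm :: "complex mat \<Rightarrow> real" where
  "spectral_norm A = Max (set (singular_values A))"

definition kappa2 :: "complex mat \<Rightarrow> real" where
  "kappa2 Z = Max (set (singular_values Z)) / Min (set (singular_values Z))"

definition sin_Theta :: "complex mat \<Rightarrow> complex mat \<Rightarrow> complex mat" where
  "sin_Theta Q Q' =
     mat_diag (dim_col Q)
       (\<lambda>i. complex_of_real (sin (arccos (singular_values (mat_adjoint Q * Q') ! i))))"

definition orthonormal_cols :: "complex mat \<Rightarrow> bool" where
  "orthonormal_cols Q \<longleftrightarrow> mat_adjoint Q * Q = 1\<^sub>m (dim_col Q)"

end

theory Submission
  imports Defs "HOL-Analysis.L2_Norm"
begin

text \<open>The column space of \<open>Xt1\<close> is invariant under \<open>At\<close>, so a unitary Schur form of the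
  compression of \<open>At\<close> to it yields an orthonormal basis \<open>P\<close> with \<open>At P = P T\<close>, where \<open>T\<close> is upper
  triangular with the diagonal of \<open>\<Lambda>t1\<close> in the given order. The rows of \<open>V2\<^sup>*\<close> are left eigenvectors
  of \<open>A\<close>, hence \<open>W = V2\<^sup>* P\<close> solves the triangular Sylvester equation
  \<open>W T - \<Lambda>2 W = V2\<^sup>* \<Delta>A P\<close>. Since the columns of \<open>T\<close> are bounded by \<open>a\<close>, forward substitution bounds
  the Frobenius norm of \<open>W\<close>, each column contributing one factor of the product. The columns of \<open>V2\<close>
  span the orthogonal complement of the column space of \<open>X1\<close>, so every sine is at most the norm of
  \<open>W\<close> divided by the least singular value of \<open>V2\<close>.\<close>

subsection \<open>Norms, adjoints and the unitary Schur form\<close>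

lemma dim_mat_adjoint [simp]:
  "dim_row (mat_adjoint A) = dim_col A" "dim_col (mat_adjoint A) = dim_row A"
  by (simp_all add: mat_adjoint_def)

lemma mat_adjoint_carrier [simp, intro]:
  "A \<in> carrier_mat n m \<Longrightarrow> mat_adjoint A \<in> carrier_mat m n"
  by (intro carrier_matI) auto

lemma index_mat_adjoint [simp]:
  fixes A :: "complex mat"
  shows "i < dim_col A \<Longrightarrow> j < dim_row A \<Longrightarrow> mat_adjoint A $$ (i, j) = cnj (A $$ (j, i))"
  by (simp add: mat_adjoint_def mat_of_rows_def conjugate_complex_def)

lemma mat_adjoint_adjoint [simp]: "mat_adjoint (mat_adjoint A) = (A :: complex mat)"
  by (rule eq_matI) auto

lemma mat_adjoint_mult:
  fixes A :: "complex mat"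
  assumes "A \<in> carrier_mat n m" "B \<in> carrier_mat m k"
  shows "mat_adjoint (A * B) = mat_adjoint B * mat_adjoint A"
  using assms by (intro eq_matI) (auto simp: scalar_prod_def intro!: sum.cong)

lemma mat_adjoint_one [simp]: "mat_adjoint (1\<^sub>m n) = (1\<^sub>m n :: complex mat)"
  by (rule eq_matI) auto

text \<open>Gives access to the triangle and Cauchy-Schwarz inequalities for
  \<open>L2_set\<close>.\<close>

lemma l2_norm_L2_set: "l2_norm v = L2_set (\<lambda>i. cmod (v $ i)) {..<dim_vec v}"
  by (simp add: l2_norm_def L2_set_def)

lemma l2_norm_nonneg [simp]: "0 \<le> l2_norm v"
  by (simp add: l2_norm_L2_set L2_set_nonneg)

lemma l2_norm_eq_0_iff: "v \<in> carrier_vec n \<Longrightarrow> l2_norm v = 0 \<longleftrightarrow> v = 0\<^sub>v n"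
  by (auto simp: l2_norm_L2_set L2_set_eq_0_iff)

lemma l2_norm_smult: "l2_norm (c \<cdot>\<^sub>v v) = cmod c * l2_norm v"
  by (auto simp: l2_norm_L2_set norm_mult L2_set_right_distrib intro!: L2_set_cong)

lemma l2_norm_add_le:
  assumes "v \<in> carrier_vec n" "w \<in> carrier_vec n"
  shows "l2_norm (v + w) \<le> l2_norm v + l2_norm w"
proof -
  have "l2_norm (v + w) \<le> L2_set (\<lambda>i. cmod (v $ i) + cmod (w $ i)) {..<n}"
    using assms by (auto simp: l2_norm_L2_set intro!: L2_set_mono norm_triangle_ineq)
  also have "\<dots> \<le> l2_norm v + l2_norm w"
    using assms L2_set_triangle_ineq by (auto simp: l2_norm_L2_set)
  finally show ?thesis .
qed

lemma cscalar_prod_eq_sum: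
  "v \<bullet>c w = (\<Sum>i<dim_vec w. v $ i * cnj (w $ i))" for v w :: "complex vec"
  by (simp add: scalar_prod_def conjugate_complex_def lessThan_atLeast0)

lemma cscalar_prod_self: "v \<bullet>c v = complex_of_real ((l2_norm v)\<^sup>2)" for v :: "complex vec"
  unfolding cscalar_prod_eq_sum l2_norm_def
  by (simp add: complex_norm_square sum_nonneg del: of_real_power flip: complex_norm_square)

lemma l2_norm_power2: "(l2_norm v)\<^sup>2 = Re (v \<bullet>c v)"
  by (simp add: cscalar_prod_self)

lemma cmod_cscalar_prod_le:
  assumes "v \<in> carrier_vec n" "w \<in> carrier_vec n"
  shows "cmod (v \<bullet>c w) \<le> l2_norm v * l2_norm w"
proof -
  have "cmod (v \<bullet>c w) \<le> (\<Sum>i<n. \<bar>cmod (v $ i)\<bar> * \<bar>cmod (w $ i)\<bar>)"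
    using assms by (auto simp: cscalar_prod_eq_sum norm_mult intro: sum_norm_le)
  also have "\<dots> \<le> l2_norm v * l2_norm w"
    using assms L2_set_mult_ineq[of "\<lambda>i. cmod (v $ i)" "\<lambda>i. cmod (w $ i)" "{..<n}"]
    by (auto simp: l2_norm_L2_set)
  finally show ?thesis .
qed

lemma cscalar_prod_mat_adjoint:
  fixes A :: "complex mat"
  assumes "A \<in> carrier_mat n m" "v \<in> carrier_vec m" "w \<in> carrier_vec n"
  shows "(A *\<^sub>v v) \<bullet>c w = v \<bullet>c (mat_adjoint A *\<^sub>v w)"
proof -
  have "(A *\<^sub>v v) \<bullet>c w = (\<Sum>i<n. \<Sum>j<m. A $$ (i, j) * v $ j * cnj (w $ i))"
    using assms by (auto simp: cscalar_prod_eq_sum scalar_prod_def sum_distrib_right lessThan_atLeast0)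
  also have "\<dots> = (\<Sum>j<m. \<Sum>i<n. A $$ (i, j) * v $ j * cnj (w $ i))"
    by (rule sum.swap)
  also have "\<dots> = v \<bullet>c (mat_adjoint A *\<^sub>v w)"
    using assms by (auto simp: cscalar_prod_eq_sum scalar_prod_def sum_distrib_left lessThan_atLeast0
        intro!: sum.cong)
  finally show ?thesis .
qed

text \<open>For \<open>z = Z^* y\<close>, moving the adjoint across the inner product gives
  \<open>|z|^2 = <Z z, y> \<le> c |z| |y|\<close>, and \<open>|z|\<close> cancels. Operator bounds
  thus pass to adjoints without any comparison of the singular values of \<open>Z\<close> and its
  adjoint.\<close>

lemma l2_norm_mat_adjoint_le:
  assumes Z: "Z \<in> carrier_mat n m" and c: "0 \<le> c"
    and bound: "\<And>v. v \<in> carrier_vec m \<Longrightarrow> l2_norm (Z *\<^sub>v v) \<le> c * l2_norm v"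
    and y: "y \<in> carrier_vec n"
  shows "l2_norm (mat_adjoint Z *\<^sub>v y) \<le> c * l2_norm y"
proof (cases "l2_norm (mat_adjoint Z *\<^sub>v y) = 0")
  case False
  let ?z = "mat_adjoint Z *\<^sub>v y"
  have z: "?z \<in> carrier_vec m" using mult_mat_vec_carrier[OF mat_adjoint_carrier[OF Z] y] .
  have "(l2_norm ?z)\<^sup>2 = cmod (?z \<bullet>c ?z)" by (simp only: cscalar_prod_self norm_of_real) simp
  also have "?z \<bullet>c ?z = (Z *\<^sub>v ?z) \<bullet>c y"
    using cscalar_prod_mat_adjoint[OF Z z y] by simp
  also have "cmod \<dots> \<le> l2_norm (Z *\<^sub>v ?z) * l2_norm y"
    using Z z y by (intro cmod_cscalar_prod_le) auto
  also have "\<dots> \<le> c * l2_norm ?z * l2_norm y"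
    using bound[OF z] by (simp add: mult_right_mono)
  finally have "l2_norm ?z * l2_norm ?z \<le> l2_norm ?z * (c * l2_norm y)"
    by (simp add: power2_eq_square mult_ac)
  moreover have "0 < l2_norm ?z" using False by (simp add: order_less_le)
  ultimately show ?thesis by simp
qed (use c in simp)

lemma l2_norm_orthonormal_mult:
  assumes Q: "Q \<in> carrier_mat n r" "mat_adjoint Q * Q = 1\<^sub>m r" and v: "v \<in> carrier_vec r"
  shows "l2_norm (Q *\<^sub>v v) = l2_norm v"
proof -
  have "(Q *\<^sub>v v) \<bullet>c (Q *\<^sub>v v) = v \<bullet>c (mat_adjoint Q *\<^sub>v (Q *\<^sub>v v))"
    using assms by (intro cscalar_prod_mat_adjoint) auto
  also have "mat_adjoint Q *\<^sub>v (Q *\<^sub>v v) = v"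
    using assms by (subst assoc_mult_mat_vec[symmetric]) auto
  finally have "(l2_norm (Q *\<^sub>v v))\<^sup>2 = (l2_norm v)\<^sup>2" by (simp add: l2_norm_power2)
  thus ?thesis by simp
qed

lemma l2_norm_adjoint_orthonormal_le:
  assumes Q: "Q \<in> carrier_mat n r" "mat_adjoint Q * Q = 1\<^sub>m r" and y: "y \<in> carrier_vec n"
  shows "l2_norm (mat_adjoint Q *\<^sub>v y) \<le> l2_norm y"
  using l2_norm_mat_adjoint_le[OF Q(1), of 1, OF _ _ y] l2_norm_orthonormal_mult[OF Q] by simp

lemma l2_norm_unit_vec [simp]: "j < n \<Longrightarrow> l2_norm (unit_vec n j) = 1"
  by (simp add: l2_norm_def if_distrib[of "\<lambda>x. (cmod x)\<^sup>2"] cong: if_cong)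

text \<open>Cauchy-Schwarz is applied to each row, and the squares are summed over the rows.\<close>

lemma l2_norm_mult_frobenius_le:
  assumes M: "M \<in> carrier_mat n m" and v: "v \<in> carrier_vec m"
  shows "l2_norm (M *\<^sub>v v) \<le> frobenius_norm M * l2_norm v"
proof -
  have "(l2_norm (M *\<^sub>v v))\<^sup>2 = (\<Sum>i<n. (cmod ((M *\<^sub>v v) $ i))\<^sup>2)"
    using M by (auto simp: l2_norm_def sum_nonneg)
  also have "\<dots> \<le> (\<Sum>i<n. (\<Sum>j<m. (cmod (M $$ (i, j)))\<^sup>2) * (l2_norm v)\<^sup>2)"
  proof (rule sum_mono)
    fix i assume i: "i \<in> {..<n}"
    have "cmod ((M *\<^sub>v v) $ i) \<le> (\<Sum>j<m. \<bar>cmod (M $$ (i, j))\<bar> * \<bar>cmod (v $ j)\<bar>)"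
      using M v i by (auto simp: scalar_prod_def norm_mult lessThan_atLeast0 intro: sum_norm_le)
    also have "\<dots> \<le> L2_set (\<lambda>j. cmod (M $$ (i, j))) {..<m} * l2_norm v"
      using v L2_set_mult_ineq[of "\<lambda>j. cmod (M $$ (i, j))" "\<lambda>j. cmod (v $ j)" "{..<m}"]
      by (auto simp: l2_norm_L2_set)
    finally have "(cmod ((M *\<^sub>v v) $ i))\<^sup>2 \<le> (L2_set (\<lambda>j. cmod (M $$ (i, j))) {..<m} * l2_norm v)\<^sup>2"
      by (intro power_mono) auto
    thus "(cmod ((M *\<^sub>v v) $ i))\<^sup>2 \<le> (\<Sum>j<m. (cmod (M $$ (i, j)))\<^sup>2) * (l2_norm v)\<^sup>2"
      by (simp add: power_mult_distrib L2_set_def sum_nonneg)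
  qed
  also have "\<dots> = (frobenius_norm M * l2_norm v)\<^sup>2"
    using M by (auto simp: frobenius_norm_def power_mult_distrib sum_nonneg sum_distrib_right)
  finally show ?thesis
    by (rule power2_le_imp_le) (simp add: frobenius_norm_def sum_nonneg)
qed

text \<open>Gram-Schmidt on a basis starting with \<open>v\<close> keeps \<open>v\<close> in front
  and produces orthogonal vectors. Dividing them by their norms makes them orthonormal and leaves
  the unit vector \<open>v\<close> unchanged.\<close>

lemma unitary_completion:
  assumes v: "v \<in> carrier_vec n" and v1: "l2_norm v = 1"
  shows "\<exists>U \<in> carrier_mat n n. mat_adjoint U * U = 1\<^sub>m n \<and> col U 0 = v"
proof -
  interpret cof_vec_space n "TYPE(complex)" .
  have v0: "v \<noteq> 0\<^sub>v n" using v1 l2_norm_eq_0_iff[OF v] by auto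
  hence n: "0 < n" using v by (cases n) auto
  define b where "b = basis_completion v"
  define ws where "ws = gram_schmidt n b"
  define W where "W = mat_of_cols n (map (\<lambda>w. complex_of_real (1 / l2_norm w) \<cdot>\<^sub>v w) ws)"
  note b = basis_completion[OF v v0, folded b_def]
  then obtain vs where bv: "b = v # vs" using n by (cases b) auto
  note gs = gram_schmidt_result[OF b(2) b(4) b(5) refl, folded ws_def]
  have "hd ws = v" using gram_schmidt_hd[OF v, of vs, folded bv] by (simp add: ws_def)
  have len: "length ws = n" using gs b by simp
  have ws0: "ws ! 0 = v" using \<open>hd ws = v\<close> len n by (metis hd_conv_nth list.size(3) not_less0)
  have wsi: "ws ! i \<in> carrier_vec n" if "i < n" for i using gs(3) len that by auto
  have W: "W \<in> carrier_mat n n" using len by (simp add: W_def carrier_matI)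
  have colW: "col W i = complex_of_real (1 / l2_norm (ws ! i)) \<cdot>\<^sub>v ws ! i" if "i < n" for i
    using that wsi[OF that] len unfolding W_def by (subst col_mat_of_cols) auto
  have "mat_adjoint W * W = 1\<^sub>m n"
  proof (rule eq_matI)
    fix i j assume ij: "i < dim_row (1\<^sub>m n :: complex mat)" "j < dim_col (1\<^sub>m n :: complex mat)"
    have "(mat_adjoint W * W) $$ (i, j) = col W j \<bullet>c col W i"
      using W ij by (auto simp: cscalar_prod_eq_sum scalar_prod_def lessThan_atLeast0 mult.commute
          intro!: sum.cong)
    also have "\<dots> = complex_of_real (1 / l2_norm (ws ! j)) * complex_of_real (1 / l2_norm (ws ! i))
        * (ws ! j \<bullet>c ws ! i)"
      using ij wsi[of i] wsi[of j] by (simp add: colW cscalar_prod_eq_sum sum_distrib_left mult_ac)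
    also have "\<dots> = (if i = j then 1 else 0)"
    proof (cases "i = j")
      case True
      \<comment> \<open>\<open>corthogonal\<close> also excludes zero vectors, so the normalising
        factors are genuine inverses.\<close>
      have "ws ! i \<bullet>c ws ! i \<noteq> 0" using corthogonalD[OF gs(2), of i i] ij len by auto
      hence "l2_norm (ws ! i) \<noteq> 0" by (auto simp: cscalar_prod_self)
      thus ?thesis using True by (simp add: cscalar_prod_self power2_eq_square)
    next
      case False
      hence "ws ! j \<bullet>c ws ! i = 0" using corthogonalD[OF gs(2), of j i] ij len by auto
      thus ?thesis using False by simp
    qed
    finally show "(mat_adjoint W * W) $$ (i, j) = 1\<^sub>m n $$ (i, j)" using ij by auto
  qed (use W in auto)
  moreover have "col W 0 = v" using colW[OF n] ws0 v1 by simp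
  ultimately show ?thesis using W by blast
qed

lemma square_mult_carrier [simp]:
  "A \<in> carrier_mat n n \<Longrightarrow> B \<in> carrier_mat n n \<Longrightarrow> A * B \<in> carrier_mat n n"
  by (rule mult_carrier_mat)

lemma mat_adjoint_block_diag:
  fixes B :: "complex mat"
  assumes "B \<in> carrier_mat m m"
  shows "mat_adjoint (four_block_mat (1\<^sub>m 1) (0\<^sub>m 1 m) (0\<^sub>m m 1) B)
    = four_block_mat (1\<^sub>m 1) (0\<^sub>m 1 m) (0\<^sub>m m 1) (mat_adjoint B)"
  using assms by (intro eq_matI) auto

text \<open>Deflation: a unit eigenvector for the head of \<open>es\<close> is completed to a
  unitary matrix, whose conjugation splits off that eigenvalue; the trailing block is treated by
  induction. The diagonal comes out in the order of the given list, which later ties the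
  \<open>j\<close>-th factor of the product to the \<open>j\<close>-th column.\<close>

lemma unitary_schur:
  fixes A :: "complex mat"
  assumes "A \<in> carrier_mat n n" "char_poly A = (\<Prod>e\<leftarrow>es. [:- e, 1:])"
  shows "\<exists>U \<in> carrier_mat n n. mat_adjoint U * U = 1\<^sub>m n \<and>
    upper_triangular (mat_adjoint U * A * U) \<and> diag_mat (mat_adjoint U * A * U) = es"
  using assms
proof (induction es arbitrary: n A)
  case Nil
  hence "n = 0" using degree_monic_char_poly[of A n] by auto
  thus ?case using Nil by (intro bexI[of _ "1\<^sub>m 0"]) (auto simp: diag_mat_def)
next
  case (Cons e es)
  note A = Cons.prems(1)
  define m where "m = n - 1"
  have "eigenvalue A e" unfolding eigenvalue_root_char_poly[OF A] Cons.prems(2) by simp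
  then obtain w where w: "w \<in> carrier_vec n" "w \<noteq> 0\<^sub>v n" "A *\<^sub>v w = e \<cdot>\<^sub>v w"
    using A by (auto simp: eigenvalue_def eigenvector_def)
  have n: "n = Suc m" using w A unfolding m_def by (cases n) auto
  define v where "v = complex_of_real (1 / l2_norm w) \<cdot>\<^sub>v w"
  have v: "v \<in> carrier_vec n" using w by (simp add: v_def)
  have v1: "l2_norm v = 1"
    using w l2_norm_eq_0_iff[OF w(1)] by (simp add: v_def l2_norm_smult norm_divide)
  have Av: "A *\<^sub>v v = e \<cdot>\<^sub>v v"
    using w A by (simp add: v_def mult_mat_vec smult_smult_assoc mult.commute)
  obtain U where U: "U \<in> carrier_mat n n" "mat_adjoint U * U = 1\<^sub>m n" "col U 0 = v"
    using unitary_completion[OF v v1] by blast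
  have Uc: "mat_adjoint U \<in> carrier_mat n n" using U by auto
  have "0 < n" using n by simp
  have col0_c: "col U 0 \<in> carrier_vec n" using U v by simp
  define A' where "A' = mat_adjoint U * A * U"
  have A': "A' \<in> carrier_mat n n" using A U by (simp add: A'_def)
  have UU: "U * mat_adjoint U = 1\<^sub>m n"
    using U by (intro mat_mult_left_right_inverse[OF _ _ U(2)]) auto
  \<comment> \<open>The first column of \<open>U\<close> is the eigenvector, so conjugation sends
    the first unit vector to \<open>e\<close> times itself.\<close>
  have "col A' 0 = mat_adjoint U *\<^sub>v (A *\<^sub>v col U 0)"
    unfolding A'_def col_mult2[OF mult_carrier_mat[OF Uc A] U(1) \<open>0 < n\<close>]
    by (rule assoc_mult_mat_vec[OF Uc A col0_c])
  also have "\<dots> = e \<cdot>\<^sub>v (mat_adjoint U *\<^sub>v col U 0)"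
    using U Av v by (simp add: mult_mat_vec[OF mat_adjoint_carrier[OF U(1)]])
  also have "mat_adjoint U *\<^sub>v col U 0 = col (mat_adjoint U * U) 0"
    using n by (subst col_mult2[OF mat_adjoint_carrier[OF U(1)] U(1)]) auto
  finally have col0: "col A' 0 = e \<cdot>\<^sub>v unit_vec n 0" using n by (simp add: U(2))
  have A'0: "A' $$ (i, 0) = (if i = 0 then e else 0)" if "i < n" for i
    using arg_cong[OF col0, of "\<lambda>u. u $ i"] that A' n by auto
  obtain A1 A2 A0 A3 where split: "split_block A' 1 1 = (A1, A2, A0, A3)"
    by (cases "split_block A' 1 1") auto
  have "dim_row A' = 1 + m" "dim_col A' = 1 + m" using A' n by auto
  note sb = split_block[OF split this]
  have A1: "A1 = mat 1 1 (\<lambda>_. e)" and A0: "A0 = 0\<^sub>m m 1"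
    using split A'0 A' n by (auto simp: split_block_def Let_def intro!: eq_matI)
  \<comment> \<open>Similarity and the zero block factor the characteristic polynomial. Cancelling
    the linear factor of \<open>e\<close> leaves \<open>char_poly A3\<close> in the form required by
    the induction hypothesis.\<close>
  have sim: "similar_mat A' A"
    unfolding similar_mat_def
    by (intro exI, rule similar_mat_witI[of "mat_adjoint U" U n]) (use A A' U UU in \<open>auto simp: A'_def\<close>)
  have "char_poly A = char_poly A1 * char_poly A3"
    using char_poly_similar[OF sim] char_poly_four_block_zeros_col[OF sb(1,2,4)] sb(5) A0 by simp
  moreover have "char_poly A1 = [:- e, 1:]"
    by (simp add: A1 char_poly_defs det_def sign_def)
  ultimately have "[:- e, 1:] * char_poly A3 = [:- e, 1:] * (\<Prod>e\<leftarrow>es. [:- e, 1:])"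
    using Cons.prems(2) by (simp only: list.map prod_list.Cons)
  hence "char_poly A3 = (\<Prod>e\<leftarrow>es. [:- e, 1:])"
    by (subst (asm) mult_left_cancel) auto
  from Cons.IH[OF sb(4) this] obtain U3 where U3: "U3 \<in> carrier_mat m m" "mat_adjoint U3 * U3 = 1\<^sub>m m"
    "upper_triangular (mat_adjoint U3 * A3 * U3)" "diag_mat (mat_adjoint U3 * A3 * U3) = es"
    by blast
  define P where "P = four_block_mat (1\<^sub>m 1) (0\<^sub>m 1 m) (0\<^sub>m m 1) U3"
  have P: "P \<in> carrier_mat n n" using U3 n by (auto simp: P_def)
  have Pa: "mat_adjoint P = four_block_mat (1\<^sub>m 1) (0\<^sub>m 1 m) (0\<^sub>m m 1) (mat_adjoint U3)"
    unfolding P_def by (rule mat_adjoint_block_diag[OF U3(1)])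
  have PP: "mat_adjoint P * P = 1\<^sub>m n"
    unfolding Pa unfolding P_def
    using U3 n by (subst mult_four_block_mat[of _ 1 1 _ m _ m _ _ 1 _ m]) auto
  have adj: "mat_adjoint (U * P) = mat_adjoint P * mat_adjoint U"
    by (rule mat_adjoint_mult[OF U(1) P])
  \<comment> \<open>Stated for every \<open>X\<close>: the choice \<open>A\<close> gives the
    triangular form, and the choice of the identity gives unitarity of \<open>U * P\<close>.\<close>
  have 1: "mat_adjoint (U * P) * X * (U * P) = mat_adjoint P * (mat_adjoint U * X * U) * P"
    if "X \<in> carrier_mat n n" for X
    using U P that unfolding adj by (simp add: assoc_mult_mat[of _ n n _ n _ n])
  have T: "mat_adjoint (U * P) * A * (U * P)
      = four_block_mat A1 (A2 * U3) (0\<^sub>m m 1) (mat_adjoint U3 * A3 * U3)"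
  proof -
    have "mat_adjoint (U * P) * A * (U * P) = mat_adjoint P * A' * P"
      using 1[OF A] by (simp add: A'_def)
    also have "mat_adjoint P * A' = four_block_mat A1 A2 A0 (mat_adjoint U3 * A3)"
      unfolding Pa sb(5) using sb(1-4) U3
      by (subst mult_four_block_mat[of _ 1 1 _ m _ m _ _ 1 _ m]) (auto simp: A0)
    also have "\<dots> * P = four_block_mat A1 (A2 * U3) (0\<^sub>m m 1) (mat_adjoint U3 * A3 * U3)"
      unfolding P_def using sb(1-4) U3
      by (subst mult_four_block_mat[of _ 1 1 _ m _ m _ _ 1 _ m]) (auto simp: A0)
    finally show ?thesis .
  qed
  have carr3: "mat_adjoint U3 * A3 * U3 \<in> carrier_mat m m" using U3 sb(4) by auto
  have "upper_triangular (mat_adjoint (U * P) * A * (U * P))"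
    unfolding T using sb(1) carr3 U3(3)
    by (intro upper_triangular_four_block) (auto simp: A1)
  moreover have "diag_mat (mat_adjoint (U * P) * A * (U * P)) = e # es"
    unfolding T diag_four_block_mat[OF sb(1) carr3] U3(4) by (simp add: A1 diag_mat_def)
  moreover have "mat_adjoint (U * P) * (U * P) = 1\<^sub>m n"
    using 1[of "1\<^sub>m n"] U P PP by (simp add: adj)
  ultimately show ?case using U P by (intro bexI[of _ "U * P"]) auto
qed

subsection \<open>Singular values\<close>

lemma mat_adjoint_mult_self_carrier [simp, intro]:
  "Z \<in> carrier_mat n m \<Longrightarrow> mat_adjoint Z * Z \<in> carrier_mat m m"
  by (rule mult_carrier_mat mat_adjoint_carrier)+

text \<open>Forgetting multiplicities turns the roots of the characteristic polynomial into the
  spectrum. Over the complex numbers their number with multiplicity is the degree, which gives the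
  length.\<close>

lemma
  assumes Z: "Z \<in> carrier_mat n m"
  shows set_singular_values:
      "set (singular_values Z) = (\<lambda>z. sqrt (Re z)) ` spectrum (mat_adjoint Z * Z)"
    and length_singular_values: "length (singular_values Z) = m"
proof -
  let ?p = "char_poly (mat_adjoint Z * Z)"
  have G: "mat_adjoint Z * Z \<in> carrier_mat m m" using Z by auto
  have p: "degree ?p = m" "?p \<noteq> 0" using degree_monic_char_poly[OF G] by auto
  show "set (singular_values Z) = (\<lambda>z. sqrt (Re z)) ` spectrum (mat_adjoint Z * Z)"
    using p spectrum_root_char_poly[OF G] by (simp add: singular_values_def)
  have "size (proots ?p) = m" using p size_proots_complex by metis
  thus "length (singular_values Z) = m"
    unfolding singular_values_def length_rev
    by (metis mset_sorted_list_of_multiset size_image_mset size_mset)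
qed

text \<open>An eigenvector \<open>w\<close> satisfies
  \<open>|Z w|^2 = <w, Z^* Z w> = cnj z * |w|^2\<close>; the witness is \<open>w\<close>
  normalised.\<close>

lemma gram_eigenvalue:
  assumes Z: "Z \<in> carrier_mat n m" and z: "z \<in> spectrum (mat_adjoint Z * Z)"
  obtains v where "v \<in> carrier_vec m" "l2_norm v = 1" "(l2_norm (Z *\<^sub>v v))\<^sup>2 = Re z"
proof -
  obtain w where w: "w \<in> carrier_vec m" "w \<noteq> 0\<^sub>v m" "mat_adjoint Z * Z *\<^sub>v w = z \<cdot>\<^sub>v w"
    using z Z by (auto simp: spectrum_def eigenvalue_def eigenvector_def)
  have lw: "l2_norm w \<noteq> 0" using w l2_norm_eq_0_iff by blast
  have "(Z *\<^sub>v w) \<bullet>c (Z *\<^sub>v w) = w \<bullet>c (mat_adjoint Z *\<^sub>v (Z *\<^sub>v w))"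
    using Z w by (intro cscalar_prod_mat_adjoint) auto
  also have "mat_adjoint Z *\<^sub>v (Z *\<^sub>v w) = z \<cdot>\<^sub>v w"
    using Z w by (simp flip: w(3) add: assoc_mult_mat_vec[OF mat_adjoint_carrier[OF Z] Z])
  also have "w \<bullet>c (z \<cdot>\<^sub>v w) = cnj z * (w \<bullet>c w)"
    using w by (simp add: cscalar_prod_eq_sum sum_distrib_left mult_ac)
  \<comment> \<open>Conjugation does not affect real parts, so comparing them avoids a separate
    proof that \<open>z\<close> is real.\<close>
  finally have "Re ((Z *\<^sub>v w) \<bullet>c (Z *\<^sub>v w)) = Re (cnj z * (w \<bullet>c w))" by simp
  hence eq: "(l2_norm (Z *\<^sub>v w))\<^sup>2 = Re z * (l2_norm w)\<^sup>2"
    by (simp add: cscalar_prod_self del: of_real_power)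
  define v where "v = complex_of_real (1 / l2_norm w) \<cdot>\<^sub>v w"
  have "v \<in> carrier_vec m" "l2_norm v = 1"
    using w lw by (simp_all add: v_def l2_norm_smult norm_divide)
  moreover have "(l2_norm (Z *\<^sub>v v))\<^sup>2 = Re z"
    using eq lw Z w
    by (simp add: v_def mult_mat_vec l2_norm_smult norm_divide power_mult_distrib power_divide)
  ultimately show ?thesis by (rule that)
qed

text \<open>Right singular vectors turn questions about one singular value, such as its sign or the
  sine belonging to it, into questions about lengths.\<close>

lemma singular_value_vector:
  assumes Z: "Z \<in> carrier_mat n m" and s: "s \<in> set (singular_values Z)"
  obtains v where "v \<in> carrier_vec m" "l2_norm v = 1" "l2_norm (Z *\<^sub>v v) = s"
proof -
  obtain z where z: "z \<in> spectrum (mat_adjoint Z * Z)" "s = sqrt (Re z)"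
    using s by (auto simp: set_singular_values[OF Z])
  obtain v where "v \<in> carrier_vec m" "l2_norm v = 1" "(l2_norm (Z *\<^sub>v v))\<^sup>2 = Re z"
    using gram_eigenvalue[OF Z z(1)] .
  thus ?thesis using z(2) by (intro that[of v]) (auto simp flip: \<open>_ = Re z\<close>)
qed

lemma singular_values_nonempty:
  assumes "Z \<in> carrier_mat n m" "0 < m"
  shows "set (singular_values Z) \<noteq> {}"
  using length_singular_values[OF assms(1)] assms(2) by auto

lemma singular_values_nonneg:
  assumes "Z \<in> carrier_mat n m" "s \<in> set (singular_values Z)"
  shows "0 \<le> s"
  using singular_value_vector[OF assms] by (metis l2_norm_nonneg)

text \<open>A unitary Schur form of the Hermitian matrix \<open>Z\<^sup>* Z\<close> is diagonal, so \<open>(l2_norm (Z v))\<^sup>2\<close> is a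
  convex combination of the squared singular values, scaled by \<open>(l2_norm v)\<^sup>2\<close>.\<close>

lemma gram_diagonalization:
  assumes Z: "Z \<in> carrier_mat n m" and v: "v \<in> carrier_vec m"
  obtains d p where "\<forall>i<m. d i \<in> set (singular_values Z)" "\<forall>i<m. 0 \<le> p i"
    "(\<Sum>i<m. p i) = (l2_norm v)\<^sup>2" "(\<Sum>i<m. (d i)\<^sup>2 * p i) = (l2_norm (Z *\<^sub>v v))\<^sup>2"
proof -
  define H where "H = mat_adjoint Z * Z"
  have H: "H \<in> carrier_mat m m" using Z by (auto simp: H_def)
  have Ha: "mat_adjoint H = H"
    unfolding H_def using Z by (subst mat_adjoint_mult[of _ m n _ m]) auto
  obtain es where es: "char_poly H = (\<Prod>e\<leftarrow>es. [:- e, 1:])" "length es = m"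
    using char_poly_factorized[OF H] by blast
  obtain U where U: "U \<in> carrier_mat m m" "mat_adjoint U * U = 1\<^sub>m m"
    and T_ut: "upper_triangular (mat_adjoint U * H * U)" and T_diag: "diag_mat (mat_adjoint U * H * U) = es"
    using unitary_schur[OF H es(1)] by blast
  define T where "T = mat_adjoint U * H * U"
  have T: "T \<in> carrier_mat m m"
    unfolding T_def by (rule mult_carrier_mat mat_adjoint_carrier H U(1))+
  have Uc: "mat_adjoint U \<in> carrier_mat m m" using U by auto
  have UU: "U * mat_adjoint U = 1\<^sub>m m"
    by (rule mat_mult_left_right_inverse[OF Uc U(1) U(2)])
  have Ta: "mat_adjoint T = T"
    unfolding T_def using U H Uc
    by (simp add: mat_adjoint_mult[of _ m m _ m] Ha assoc_mult_mat[of _ m m _ m _ m])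
  \<comment> \<open>Below the diagonal this is triangularity; above it, the Hermitian symmetry
    \<open>Ta\<close> reflects the zero.\<close>
  have T0: "T $$ (i, j) = 0" if "i < m" "j < m" "i \<noteq> j" for i j
  proof (cases "j < i")
    case True thus ?thesis using T_ut T that by (auto simp: T_def[symmetric])
  next
    case False
    hence "T $$ (j, i) = 0" using T_ut T that by (auto simp: T_def[symmetric])
    hence "mat_adjoint T $$ (i, j) = 0" using T that by simp
    thus ?thesis by (simp add: Ta)
  qed
  have Tev: "T $$ (i, i) \<in> spectrum H" if "i < m" for i
  proof -
    have "T $$ (i, i) \<in> set es"
      using that T T_diag by (auto simp: T_def[symmetric] diag_mat_def)
    thus ?thesis
      by (auto simp: spectrum_root_char_poly[OF H] es(1) poly_prod_list prod_list_zero_iff image_iff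
          intro!: bexI[of _ "T $$ (i, i)"])
  qed
  \<comment> \<open>The coordinates of \<open>v\<close> in the eigenbasis of \<open>H\<close>; the
    squares of their moduli serve as the weights \<open>p\<close>.\<close>
  define u where "u = mat_adjoint U *\<^sub>v v"
  have u: "u \<in> carrier_vec m" unfolding u_def by (rule mult_mat_vec_carrier[OF Uc v])
  have Uu: "U *\<^sub>v u = v"
    using assoc_mult_mat_vec[OF U(1) Uc v] UU v by (simp add: u_def)
  have "(Z *\<^sub>v v) \<bullet>c (Z *\<^sub>v v) = v \<bullet>c (mat_adjoint Z *\<^sub>v (Z *\<^sub>v v))"
    using Z v by (intro cscalar_prod_mat_adjoint) auto
  also have "mat_adjoint Z *\<^sub>v (Z *\<^sub>v v) = H *\<^sub>v v"
    using assoc_mult_mat_vec[OF mat_adjoint_carrier[OF Z] Z v] by (simp add: H_def)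
  also have "v \<bullet>c (H *\<^sub>v v) = (U *\<^sub>v u) \<bullet>c (H *\<^sub>v v)"
    by (simp add: Uu)
  also have "\<dots> = u \<bullet>c (mat_adjoint U *\<^sub>v (H *\<^sub>v v))"
    using U H u v by (intro cscalar_prod_mat_adjoint) auto
  also have "mat_adjoint U *\<^sub>v (H *\<^sub>v v) = T *\<^sub>v u"
  proof -
    have "T *\<^sub>v u = mat_adjoint U * H *\<^sub>v (U *\<^sub>v u)"
      unfolding T_def by (rule assoc_mult_mat_vec[OF mult_carrier_mat[OF Uc H] U(1) u])
    thus ?thesis using assoc_mult_mat_vec[OF Uc H v] by (simp add: Uu)
  qed
  also have "u \<bullet>c (T *\<^sub>v u) = (\<Sum>i<m. u $ i * cnj (T $$ (i, i) * u $ i))"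
  proof -
    have "(T *\<^sub>v u) $ i = T $$ (i, i) * u $ i" if i: "i < m" for i
    proof -
      have "(T *\<^sub>v u) $ i = (\<Sum>j\<in>{0..<m}. T $$ (i, j) * u $ j)"
        using T u i by (simp add: scalar_prod_def)
      also have "\<dots> = (\<Sum>j\<in>{0..<m}. if j = i then T $$ (i, i) * u $ i else 0)"
        using T0 i by (intro sum.cong) auto
      finally show ?thesis using i by simp
    qed
    thus ?thesis using T by (simp add: cscalar_prod_eq_sum)
  qed
  finally have "(l2_norm (Z *\<^sub>v v))\<^sup>2 = (\<Sum>i<m. Re (u $ i * cnj (T $$ (i, i) * u $ i)))"
    by (simp add: l2_norm_power2)
  also have "\<dots> = (\<Sum>i<m. Re (T $$ (i, i)) * (cmod (u $ i))\<^sup>2)"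
    by (intro sum.cong refl) (simp only: cmod_power2, simp add: algebra_simps power2_eq_square)
  finally have Zv: "(l2_norm (Z *\<^sub>v v))\<^sup>2 = (\<Sum>i<m. Re (T $$ (i, i)) * (cmod (u $ i))\<^sup>2)" .
  have "l2_norm u = l2_norm v"
    unfolding u_def using UU v by (intro l2_norm_orthonormal_mult[OF Uc]) auto
  moreover have "(l2_norm u)\<^sup>2 = (\<Sum>i<m. (cmod (u $ i))\<^sup>2)"
    using u by (auto simp: l2_norm_def sum_nonneg)
  ultimately have un: "(\<Sum>i<m. (cmod (u $ i))\<^sup>2) = (l2_norm v)\<^sup>2" by simp
  \<comment> \<open>Nonnegativity makes squaring undo the square root in the witness for
    \<open>d\<close>.\<close>
  have Tpos: "0 \<le> Re (T $$ (i, i))" if "i < m" for i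
    using gram_eigenvalue[OF Z Tev[OF that, unfolded H_def]] by (metis zero_le_power2)
  show ?thesis
  proof (rule that[of "\<lambda>i. sqrt (Re (T $$ (i, i)))" "\<lambda>i. (cmod (u $ i))\<^sup>2"])
    show "\<forall>i<m. sqrt (Re (T $$ (i, i))) \<in> set (singular_values Z)"
      using Tev by (auto simp: set_singular_values[OF Z] H_def)
    show "(\<Sum>i<m. (sqrt (Re (T $$ (i, i))))\<^sup>2 * (cmod (u $ i))\<^sup>2) = (l2_norm (Z *\<^sub>v v))\<^sup>2"
      using Tpos by (simp add: Zv)
  qed (use un in auto)
qed

text \<open>In \<open>gram_diagonalization\<close> every \<open>d i\<close> is replaced by the
  largest singular value.\<close>

lemma l2_norm_mult_le_spectral_norm:
  assumes Z: "Z \<in> carrier_mat n m" and m: "0 < m" and v: "v \<in> carrier_vec m"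
  shows "l2_norm (Z *\<^sub>v v) \<le> spectral_norm Z * l2_norm v"
proof -
  obtain d p where dp: "\<forall>i<m. d i \<in> set (singular_values Z)" "\<forall>i<m. 0 \<le> p i"
    "(\<Sum>i<m. p i) = (l2_norm v)\<^sup>2" "(\<Sum>i<m. (d i)\<^sup>2 * p i) = (l2_norm (Z *\<^sub>v v))\<^sup>2"
    using gram_diagonalization[OF Z v] by blast
  have d: "0 \<le> d i \<and> d i \<le> spectral_norm Z" if "i < m" for i
    using dp(1) that singular_values_nonneg[OF Z] by (auto simp: spectral_norm_def)
  have "(l2_norm (Z *\<^sub>v v))\<^sup>2 \<le> (\<Sum>i<m. (spectral_norm Z)\<^sup>2 * p i)"
    unfolding dp(4)[symmetric] using d dp(2) by (intro sum_mono mult_right_mono power_mono) auto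
  also have "\<dots> = (spectral_norm Z * l2_norm v)\<^sup>2"
    by (simp add: sum_distrib_left[symmetric] dp(3) power_mult_distrib)
  finally show ?thesis
    by (rule power2_le_imp_le) (use d[OF m] in auto)
qed

text \<open>The same weighted sum, with every \<open>d i\<close> replaced by the least singular
  value.\<close>

lemma min_singular_value_le_l2_norm_mult:
  assumes Z: "Z \<in> carrier_mat n m" and m: "0 < m" and v: "v \<in> carrier_vec m"
  shows "Min (set (singular_values Z)) * l2_norm v \<le> l2_norm (Z *\<^sub>v v)"
proof -
  let ?s = "Min (set (singular_values Z))"
  obtain d p where dp: "\<forall>i<m. d i \<in> set (singular_values Z)" "\<forall>i<m. 0 \<le> p i"
    "(\<Sum>i<m. p i) = (l2_norm v)\<^sup>2" "(\<Sum>i<m. (d i)\<^sup>2 * p i) = (l2_norm (Z *\<^sub>v v))\<^sup>2"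
    using gram_diagonalization[OF Z v] by blast
  have "?s \<in> set (singular_values Z)" using singular_values_nonempty[OF Z m] by auto
  hence s: "0 \<le> ?s" by (rule singular_values_nonneg[OF Z])
  have "(?s * l2_norm v)\<^sup>2 = (\<Sum>i<m. ?s\<^sup>2 * p i)"
    by (simp add: sum_distrib_left[symmetric] dp(3) power_mult_distrib)
  also have "\<dots> \<le> (l2_norm (Z *\<^sub>v v))\<^sup>2"
    unfolding dp(4)[symmetric] using s dp by (intro sum_mono mult_right_mono power_mono) auto
  finally show ?thesis by (rule power2_le_imp_le) simp
qed

lemma spectral_norm_nonneg:
  assumes "Z \<in> carrier_mat n m" "0 < m"
  shows "0 \<le> spectral_norm Z"
  unfolding spectral_norm_def
  by (rule singular_values_nonneg[OF assms(1) Max_in[OF finite_set singular_values_nonempty[OF assms]]])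

section \<open>Orthogonal projections and the sines of the canonical angles\<close>

lemma l2_norm_add_orthogonal:
  assumes "v \<in> carrier_vec n" "w \<in> carrier_vec n" "v \<bullet>c w = 0"
  shows "(l2_norm (v + w))\<^sup>2 = (l2_norm v)\<^sup>2 + (l2_norm w)\<^sup>2"
proof -
  have "(v + w) \<bullet>c (v + w) = v \<bullet>c v + w \<bullet>c w + v \<bullet>c w + cnj (v \<bullet>c w)"
    using assms(1,2) by (simp add: cscalar_prod_eq_sum sum.distrib algebra_simps)
  thus ?thesis using assms(3) by (simp add: l2_norm_power2)
qed

text \<open>Pythagoras for \<open>x\<close> as its projection plus the orthogonal remainder
  \<open>y\<close>; the projection has the length of \<open>Q^* x\<close> because \<open>Q\<close>
  is an isometry.\<close>

lemma l2_norm_projection_complement: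
  assumes Q: "Q \<in> carrier_mat n r" "mat_adjoint Q * Q = 1\<^sub>m r" and x: "x \<in> carrier_vec n"
  defines "y \<equiv> x - Q *\<^sub>v (mat_adjoint Q *\<^sub>v x)"
  shows "mat_adjoint Q *\<^sub>v y = 0\<^sub>v r"
    and "(l2_norm y)\<^sup>2 = (l2_norm x)\<^sup>2 - (l2_norm (mat_adjoint Q *\<^sub>v x))\<^sup>2"
proof -
  let ?w = "mat_adjoint Q *\<^sub>v x"
  have w: "?w \<in> carrier_vec r" by (rule mult_mat_vec_carrier[OF mat_adjoint_carrier[OF Q(1)] x])
  have Qw: "Q *\<^sub>v ?w \<in> carrier_vec n" by (rule mult_mat_vec_carrier[OF Q(1) w])
  have y: "y \<in> carrier_vec n" using x Qw by (simp add: y_def)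
  have "mat_adjoint Q *\<^sub>v (Q *\<^sub>v ?w) = ?w"
    using assoc_mult_mat_vec[OF mat_adjoint_carrier[OF Q(1)] Q(1) w] w by (simp add: Q(2))
  thus Qy: "mat_adjoint Q *\<^sub>v y = 0\<^sub>v r"
    using w unfolding y_def mult_minus_distrib_mat_vec[OF mat_adjoint_carrier[OF Q(1)] x Qw] by simp
  have "(Q *\<^sub>v ?w) \<bullet>c y = ?w \<bullet>c (mat_adjoint Q *\<^sub>v y)"
    by (rule cscalar_prod_mat_adjoint[OF Q(1) w y])
  hence "(Q *\<^sub>v ?w) \<bullet>c y = 0" using w by (simp add: Qy)
  moreover have "z + (x - z) = x" if "z \<in> carrier_vec n" for z
    using that x by (intro eq_vecI) auto
  from this[OF Qw] have "Q *\<^sub>v ?w + y = x" by (simp add: y_def)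
  ultimately have "(l2_norm x)\<^sup>2 = (l2_norm (Q *\<^sub>v ?w))\<^sup>2 + (l2_norm y)\<^sup>2"
    using l2_norm_add_orthogonal[OF Qw y] by simp
  thus "(l2_norm y)\<^sup>2 = (l2_norm x)\<^sup>2 - (l2_norm ?w)\<^sup>2"
    using l2_norm_orthonormal_mult[OF Q w] by simp
qed

text \<open>The spectral norm is attained at a unit vector, each of whose coordinates is scaled by a
  factor of modulus at most \<open>c\<close>.\<close>

lemma spectral_norm_mat_diag_le:
  assumes r: "0 < r" and d: "\<And>i. i < r \<Longrightarrow> cmod (d i) \<le> c"
  shows "spectral_norm (mat_diag r d) \<le> c"
proof -
  have D: "mat_diag r d \<in> carrier_mat r r" by simp
  have c: "0 \<le> c" using d[OF r] norm_ge_zero order_trans by blast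
  have "spectral_norm (mat_diag r d) \<in> set (singular_values (mat_diag r d))"
    unfolding spectral_norm_def using singular_values_nonempty[OF D r] by auto
  then obtain x where x: "x \<in> carrier_vec r" "l2_norm x = 1"
    "l2_norm (mat_diag r d *\<^sub>v x) = spectral_norm (mat_diag r d)"
    using singular_value_vector[OF D] by metis
  have "(mat_diag r d *\<^sub>v x) $ i = d i * x $ i" if "i < r" for i
  proof -
    have "(mat_diag r d *\<^sub>v x) $ i = (\<Sum>j\<in>{0..<r}. (if i = j then d j else 0) * x $ j)"
      using x(1) that by (simp add: scalar_prod_def mat_diag_def)
    also have "\<dots> = (\<Sum>j\<in>{0..<r}. if j = i then d i * x $ i else 0)"
      by (intro sum.cong) auto
    finally show ?thesis using that by simp
  qed
  moreover have "dim_row (mat_diag r d) = r" by (simp add: mat_diag_def)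
  ultimately have "l2_norm (mat_diag r d *\<^sub>v x) \<le> L2_set (\<lambda>i. c * cmod (x $ i)) {..<r}"
    using d by (auto simp: l2_norm_L2_set norm_mult intro!: L2_set_mono mult_right_mono)
  also have "\<dots> = c"
    using x c by (auto simp: L2_set_right_distrib[symmetric] l2_norm_L2_set)
  finally show ?thesis by (simp add: x(3))
qed

text \<open>A singular value \<open>z\<close> of \<open>Q^* Qt\<close> equals
  \<open>|Q^* Qt v|\<close> for some unit \<open>v\<close>, and by Pythagoras
  \<open>sin (arccos z) = sqrt (1 - z^2)\<close> is the distance of \<open>Qt v\<close> from the
  column space of \<open>Q\<close>. A uniform bound on such distances therefore bounds every
  sine.\<close>

lemma spectral_norm_sin_Theta_le:
  assumes Q: "Q \<in> carrier_mat n r" "mat_adjoint Q * Q = 1\<^sub>m r"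
    and Qt: "Qt \<in> carrier_mat n r" "mat_adjoint Qt * Qt = 1\<^sub>m r" and r: "0 < r"
    and c: "\<And>v. v \<in> carrier_vec r \<Longrightarrow> l2_norm v = 1 \<Longrightarrow>
      l2_norm (Qt *\<^sub>v v - Q *\<^sub>v (mat_adjoint Q *\<^sub>v (Qt *\<^sub>v v))) \<le> c"
  shows "spectral_norm (sin_Theta Q Qt) \<le> c"
proof -
  define M where "M = mat_adjoint Q * Qt"
  have M: "M \<in> carrier_mat r r"
    unfolding M_def by (rule mult_carrier_mat mat_adjoint_carrier Q(1) Qt(1))+
  have "cmod (complex_of_real (sin (arccos (singular_values M ! i)))) \<le> c" if i: "i < r" for i
  proof -
    let ?z = "singular_values M ! i"
    have "?z \<in> set (singular_values M)" using i length_singular_values[OF M] by simp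
    then obtain v where v: "v \<in> carrier_vec r" "l2_norm v = 1" "l2_norm (M *\<^sub>v v) = ?z"
      using singular_value_vector[OF M] by metis
    have x: "Qt *\<^sub>v v \<in> carrier_vec n" by (rule mult_mat_vec_carrier[OF Qt(1) v(1)])
    have xn: "l2_norm (Qt *\<^sub>v v) = 1" using l2_norm_orthonormal_mult[OF Qt v(1)] v by simp
    have Mv: "M *\<^sub>v v = mat_adjoint Q *\<^sub>v (Qt *\<^sub>v v)"
      unfolding M_def by (rule assoc_mult_mat_vec[OF mat_adjoint_carrier[OF Q(1)] Qt(1) v(1)])
    \<comment> \<open>The upper bound holds because \<open>Q^*\<close> is a contraction; it places
      \<open>?z\<close> in the domain where \<open>arccos\<close> inverts the cosine.\<close>
    have z: "0 \<le> ?z" "?z \<le> 1"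
      using l2_norm_adjoint_orthonormal_le[OF Q x] xn Mv v(3) l2_norm_nonneg[of "M *\<^sub>v v"] by auto
    have "sin (arccos ?z) = sqrt (1 - ?z\<^sup>2)" using z by (intro sin_arccos) auto
    also have "1 - ?z\<^sup>2 = (l2_norm (Qt *\<^sub>v v - Q *\<^sub>v (mat_adjoint Q *\<^sub>v (Qt *\<^sub>v v))))\<^sup>2"
      using l2_norm_projection_complement(2)[OF Q x] xn Mv v(3) by simp
    finally show ?thesis using c[OF v(1,2)] by simp
  qed
  thus ?thesis
    using r Qt Q unfolding sin_Theta_def M_def[symmetric] by (auto intro: spectral_norm_mat_diag_le)
qed

subsection \<open>The triangular Sylvester equation\<close>

text \<open>With \<open>s\<close> the square root of the partial sum, the hypothesis gives an affine
  recursion for \<open>s\<close>. Shifting by its fixed point, that is passing to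
  \<open>s + E / a\<close>, makes the recursion multiplicative with factor
  \<open>1 + a / g r\<close>.\<close>

lemma sum_squares_recursion_bound:
  fixes w g :: "nat \<Rightarrow> real"
  assumes "\<And>j. 0 \<le> w j" "\<And>j. j < r \<Longrightarrow> 0 < g j" "0 < a"
    and "\<And>j. j < r \<Longrightarrow> g j * w j \<le> E + a * sqrt (\<Sum>i<j. (w i)\<^sup>2)"
  shows "sqrt (\<Sum>i<r. (w i)\<^sup>2) + E / a \<le> E / a * (\<Prod>j<r. 1 + a / g j)"
  using assms(2,4)
proof (induction r)
  case (Suc r)
  let ?s = "\<lambda>r. sqrt (\<Sum>i<r. (w i)\<^sup>2)"
  have g: "0 < g r" using Suc.prems by simp
  have IH: "?s r + E / a \<le> E / a * (\<Prod>j<r. 1 + a / g j)"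
    using Suc.prems by (intro Suc.IH) auto
  have "?s (Suc r) = sqrt ((?s r)\<^sup>2 + (w r)\<^sup>2)" by (simp add: sum_nonneg)
  also have "\<dots> \<le> ?s r + w r"
    using assms(1) by (intro sqrt_sum_squares_le_sum) (auto simp: sum_nonneg)
  also have "?s r + w r \<le> ?s r + (E + a * ?s r) / g r"
    using Suc.prems(2)[of r] g by (simp add: pos_le_divide_eq mult.commute)
  also have "?s r + (E + a * ?s r) / g r = (?s r + E / a) * (1 + a / g r) - E / a"
    using g \<open>0 < a\<close> by (simp add: field_simps)
  finally have "?s (Suc r) + E / a \<le> (?s r + E / a) * (1 + a / g r)" by simp
  also have "\<dots> \<le> E / a * (\<Prod>j<r. 1 + a / g j) * (1 + a / g r)"
    using IH g \<open>0 < a\<close> by (intro mult_right_mono) auto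
  finally show ?case by (simp add: mult_ac)
qed simp

text \<open>The Sylvester equation \<open>W T - D W = N\<close> is solved column by column by forward substitution.\<close>

lemma frobenius_norm_sylvester_triangular:
  assumes W: "W \<in> carrier_mat m r" and T: "T \<in> carrier_mat r r" "upper_triangular T"
    and D: "D \<in> carrier_mat m m" "diagonal_mat D"
    and N: "N \<in> carrier_mat m r" and eq: "W * T = D * W + N"
    and N_le: "\<And>j. j < r \<Longrightarrow> l2_norm (col N j) \<le> E"
    and T_le: "\<And>j. j < r \<Longrightarrow> l2_norm (col T j) \<le> a" and a: "0 < a"
    and gap: "\<And>j. j < r \<Longrightarrow> 0 < g j"
      "\<And>j k. j < r \<Longrightarrow> k < m \<Longrightarrow> g j \<le> cmod (T $$ (j, j) - D $$ (k, k))"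
  shows "frobenius_norm W + E / a \<le> E / a * (\<Prod>j<r. 1 + a / g j)"
proof -
  define w where "w i = L2_set (\<lambda>k. cmod (W $$ (k, i))) {..<m}" for i
  have w2: "(w i)\<^sup>2 = (\<Sum>k<m. (cmod (W $$ (k, i)))\<^sup>2)" for i
    by (simp add: w_def L2_set_def sum_nonneg)
  have "g j * w j \<le> E + a * sqrt (\<Sum>i<j. (w i)\<^sup>2)" if j: "j < r" for j
  proof -
    \<comment> \<open>The norm of the part of row \<open>k\<close> that earlier columns have already
      determined.\<close>
    let ?p = "\<lambda>k. L2_set (\<lambda>i. cmod (W $$ (k, i))) {..<j}"
    have entry: "g j * cmod (W $$ (k, j)) \<le> cmod (N $$ (k, j)) + a * ?p k" if k: "k < m" for k
    proof -
      have "(W * T) $$ (k, j) = (\<Sum>i<r. W $$ (k, i) * T $$ (i, j))"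
        using W T j k by (simp add: scalar_prod_def lessThan_atLeast0)
      also have "\<dots> = (\<Sum>i<Suc j. W $$ (k, i) * T $$ (i, j))"
      proof (intro sum.mono_neutral_right ballI)
        fix i assume "i \<in> {..<r} - {..<Suc j}"
        hence "T $$ (i, j) = 0" using T by auto
        thus "W $$ (k, i) * T $$ (i, j) = 0" by simp
      qed (use j in auto)
      finally have 1: "(W * T) $$ (k, j) = (\<Sum>i<j. W $$ (k, i) * T $$ (i, j)) + W $$ (k, j) * T $$ (j, j)"
        by simp
      have "(D * W) $$ (k, j) = (\<Sum>i\<in>{0..<m}. D $$ (k, i) * W $$ (i, j))"
        using W D j k by (simp add: scalar_prod_def)
      also have "\<dots> = (\<Sum>i\<in>{0..<m}. if i = k then D $$ (k, k) * W $$ (k, j) else 0)"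
        using D k by (intro sum.cong) (auto simp: diagonal_mat_def)
      finally have 2: "(D * W) $$ (k, j) = D $$ (k, k) * W $$ (k, j)" using k by simp
      have "(W * T) $$ (k, j) = (D * W) $$ (k, j) + N $$ (k, j)"
        unfolding eq using D W N j k by simp
      \<comment> \<open>As \<open>D\<close> is diagonal the rows decouple, and as \<open>T\<close>
        is triangular only columns before \<open>j\<close> remain on the right-hand side.\<close>
      hence "(T $$ (j, j) - D $$ (k, k)) * W $$ (k, j)
          = N $$ (k, j) - (\<Sum>i<j. W $$ (k, i) * T $$ (i, j))"
        unfolding 1 2 by (simp add: algebra_simps)
      hence "cmod (T $$ (j, j) - D $$ (k, k)) * cmod (W $$ (k, j))
          = cmod (N $$ (k, j) - (\<Sum>i<j. W $$ (k, i) * T $$ (i, j)))"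
        by (simp only: norm_mult[symmetric])
      also have "\<dots> \<le> cmod (N $$ (k, j)) + cmod (\<Sum>i<j. W $$ (k, i) * T $$ (i, j))"
        by (rule norm_triangle_ineq4)
      also have "cmod (\<Sum>i<j. W $$ (k, i) * T $$ (i, j))
          \<le> (\<Sum>i<j. \<bar>cmod (W $$ (k, i))\<bar> * \<bar>cmod (T $$ (i, j))\<bar>)"
        by (auto simp: norm_mult intro: sum_norm_le)
      also have "\<dots> \<le> ?p k * L2_set (\<lambda>i. cmod (T $$ (i, j))) {..<j}"
        by (rule L2_set_mult_ineq)
      \<comment> \<open>The entries of column \<open>j\<close> above the diagonal form part of the
        full column, whose norm is at most \<open>a\<close>.\<close>
      also have "\<dots> \<le> ?p k * a"
      proof (intro mult_left_mono)
        have "L2_set (\<lambda>i. cmod (T $$ (i, j))) {..<j} \<le> l2_norm (col T j)"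
          using j T by (auto simp: L2_set_def l2_norm_def intro!: sum_mono2)
        thus "L2_set (\<lambda>i. cmod (T $$ (i, j))) {..<j} \<le> a" using T_le[OF j] by simp
      qed (simp add: L2_set_nonneg)
      finally have "cmod (T $$ (j, j) - D $$ (k, k)) * cmod (W $$ (k, j)) \<le> cmod (N $$ (k, j)) + a * ?p k"
        by (simp add: mult.commute)
      moreover have "g j * cmod (W $$ (k, j)) \<le> cmod (T $$ (j, j) - D $$ (k, k)) * cmod (W $$ (k, j))"
        using gap(2)[OF j k] by (intro mult_right_mono) auto
      ultimately show ?thesis by linarith
    qed
    have "g j * w j = L2_set (\<lambda>k. g j * cmod (W $$ (k, j))) {..<m}"
      unfolding w_def using gap(1)[OF j] by (intro L2_set_right_distrib) auto
    also have "\<dots> \<le> L2_set (\<lambda>k. cmod (N $$ (k, j)) + a * ?p k) {..<m}"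
      using entry gap(1)[OF j] by (intro L2_set_mono) auto
    also have "\<dots> \<le> L2_set (\<lambda>k. cmod (N $$ (k, j))) {..<m} + L2_set (\<lambda>k. a * ?p k) {..<m}"
      by (rule L2_set_triangle_ineq)
    also have "L2_set (\<lambda>k. cmod (N $$ (k, j))) {..<m} = l2_norm (col N j)"
      using N j by (auto simp: l2_norm_L2_set intro!: L2_set_cong)
    also have "L2_set (\<lambda>k. a * ?p k) {..<m} = a * L2_set ?p {..<m}"
      using a by (simp add: L2_set_right_distrib)
    \<comment> \<open>Both sides are the Frobenius norm of the first \<open>j\<close> columns of
      \<open>W\<close>, summed by rows and by columns.\<close>
    also have "L2_set ?p {..<m} = sqrt (\<Sum>i<j. (w i)\<^sup>2)"
      unfolding w2 by (subst sum.swap) (simp add: L2_set_def sum_nonneg)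
    finally show ?thesis using N_le[OF j] by linarith
  qed
  hence "sqrt (\<Sum>i<r. (w i)\<^sup>2) + E / a \<le> E / a * (\<Prod>j<r. 1 + a / g j)"
    using a gap(1) by (intro sum_squares_recursion_bound) (auto simp: w_def L2_set_nonneg)
  moreover have "(\<Sum>i<r. (w i)\<^sup>2) = (\<Sum>k<m. \<Sum>i<r. (cmod (W $$ (k, i)))\<^sup>2)"
    unfolding w2 by (rule sum.swap)
  ultimately show ?thesis using W by (simp add: frobenius_norm_def)
qed

subsection \<open>Eigenblocks and invariant subspaces\<close>

lemma diagonal_imp_upper_triangular:
  "diagonal_mat D \<Longrightarrow> D \<in> carrier_mat m m \<Longrightarrow> upper_triangular D"
  by (auto simp: diagonal_mat_def)

lemma diagonal_entry_in_spectrum: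
  fixes D :: "complex mat"
  assumes D: "D \<in> carrier_mat m m" "diagonal_mat D" and k: "k < m"
  shows "D $$ (k, k) \<in> spectrum D"
proof -
  have "D $$ (k, k) \<in> set (diag_mat D)" using D k by (auto simp: diag_mat_def)
  thus ?thesis
    using char_poly_upper_triangular[OF D(1) diagonal_imp_upper_triangular[OF D(2,1)]]
    by (auto simp: spectrum_root_char_poly[OF D(1)] poly_prod_list prod_list_zero_iff image_iff
        intro!: bexI[of _ "D $$ (k, k)"])
qed

lemma append_cols_carrier:
  assumes "A \<in> carrier_mat n r" "B \<in> carrier_mat n m"
  shows "append_cols A B \<in> carrier_mat n (r + m)"
  using assms by (auto simp: append_cols_def)

lemma index_append_cols:
  assumes "A \<in> carrier_mat n r" "B \<in> carrier_mat n m" "i < n" "j < r + m"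
  shows "append_cols A B $$ (i, j) = (if j < r then A $$ (i, j) else B $$ (i, j - r))"
  using assms by (auto simp: append_cols_def mat_of_cols_def nth_append)

lemma sum_lessThan_add:
  fixes f :: "nat \<Rightarrow> 'a::comm_monoid_add"
  shows "(\<Sum>l<r + m. f l) = (\<Sum>l<r. f l) + (\<Sum>l<m. f (r + l))"
  by (induction m) (simp_all add: add_ac)

text \<open>Applied to \<open>X\<close> and the adjoint of its inverse, this splits the identity
  into two complementary oblique projections.\<close>

lemma append_cols_mult_adjoint:
  assumes A: "A \<in> carrier_mat n r" "B \<in> carrier_mat n m"
    and C: "C \<in> carrier_mat k r" "D \<in> carrier_mat k m"
  shows "append_cols A B * mat_adjoint (append_cols C D) = A * mat_adjoint C + B * mat_adjoint D"
proof (rule eq_matI)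
  note carr = append_cols_carrier[OF A] append_cols_carrier[OF C]
  fix i j assume "i < dim_row (A * mat_adjoint C + B * mat_adjoint D)"
    "j < dim_col (A * mat_adjoint C + B * mat_adjoint D)"
  hence ij: "i < n" "j < k" using A C by auto
  have "(append_cols A B * mat_adjoint (append_cols C D)) $$ (i, j)
      = (\<Sum>l<r + m. append_cols A B $$ (i, l) * cnj (append_cols C D $$ (j, l)))"
    using carr ij by (simp add: scalar_prod_def lessThan_atLeast0[symmetric])
  also have "\<dots> = (A * mat_adjoint C + B * mat_adjoint D) $$ (i, j)"
    using A C ij by (simp add: sum_lessThan_add index_append_cols[OF A] index_append_cols[OF C]
        scalar_prod_def lessThan_atLeast0[symmetric])
  finally show "(append_cols A B * mat_adjoint (append_cols C D)) $$ (i, j)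
      = (A * mat_adjoint C + B * mat_adjoint D) $$ (i, j)" .
qed (use append_cols_carrier[OF A] append_cols_carrier[OF C] A C in auto)

text \<open>These are the two lower blocks of the product of the inverse with \<open>X\<close>: row
  \<open>k\<close> of the adjoint of \<open>V2\<close> is row \<open>r + k\<close> of the
  inverse.\<close>

lemma
  assumes X: "X1 \<in> carrier_mat n r" "X2 \<in> carrier_mat n m" and n: "n = r + m"
    and V: "V1 \<in> carrier_mat n r" "V2 \<in> carrier_mat n m"
    and one: "mat_adjoint (append_cols V1 V2) * append_cols X1 X2 = 1\<^sub>m n"
  shows dual_blocks_orthogonal: "mat_adjoint V2 * X1 = 0\<^sub>m m r"
    and dual_blocks_inverse: "mat_adjoint V2 * X2 = 1\<^sub>m m"
proof -
  note carr = append_cols_carrier[OF X] append_cols_carrier[OF V]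
  have entry: "(\<Sum>l<n. cnj (append_cols V1 V2 $$ (l, i)) * append_cols X1 X2 $$ (l, j))
      = (if i = j then 1 else 0)" if "i < n" "j < n" for i j
    using arg_cong[OF one, of "\<lambda>M. M $$ (i, j)"] carr that n
    by (simp add: scalar_prod_def lessThan_atLeast0)
  show "mat_adjoint V2 * X1 = 0\<^sub>m m r"
  proof (rule eq_matI)
    fix k j assume kj: "k < dim_row (0\<^sub>m m r :: complex mat)" "j < dim_col (0\<^sub>m m r :: complex mat)"
    thus "(mat_adjoint V2 * X1) $$ (k, j) = 0\<^sub>m m r $$ (k, j)"
      using entry[of "r + k" j] X V n
      by (simp add: scalar_prod_def lessThan_atLeast0 index_append_cols[OF X] index_append_cols[OF V])
  qed (use X V in auto)
  show "mat_adjoint V2 * X2 = 1\<^sub>m m"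
  proof (rule eq_matI)
    fix k j assume kj: "k < dim_row (1\<^sub>m m :: complex mat)" "j < dim_col (1\<^sub>m m :: complex mat)"
    thus "(mat_adjoint V2 * X2) $$ (k, j) = 1\<^sub>m m $$ (k, j)"
      using entry[of "r + k" "r + j"] X V n
      by (simp add: scalar_prod_def lessThan_atLeast0 index_append_cols[OF X] index_append_cols[OF V])
  qed (use X V in auto)
qed

text \<open>The two column blocks of \<open>eig\<close> are compared; splitting the sum at
  \<open>r\<close> isolates the zero blocks.\<close>

lemma
  assumes A: "A \<in> carrier_mat n n"
    and X: "X1 \<in> carrier_mat n r" "X2 \<in> carrier_mat n m"
    and L: "L1 \<in> carrier_mat r r" "L2 \<in> carrier_mat m m"
    and eig: "A * append_cols X1 X2 = append_cols X1 X2 * block_diag L1 L2"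
  shows eigenblock_left: "A * X1 = X1 * L1"
    and eigenblock_right: "A * X2 = X2 * L2"
proof -
  note carr = append_cols_carrier[OF X]
  have B: "block_diag L1 L2 \<in> carrier_mat (r + m) (r + m)"
    using L by (simp add: block_diag_def)
  have B_ix: "block_diag L1 L2 $$ (i, j) = (if i < r then if j < r then L1 $$ (i, j) else 0
      else if j < r then 0 else L2 $$ (i - r, j - r))" if "i < r + m" "j < r + m" for i j
    using L that by (auto simp: block_diag_def)
  have entry: "(\<Sum>l<n. A $$ (i, l) * append_cols X1 X2 $$ (l, j))
      = (\<Sum>l<r. append_cols X1 X2 $$ (i, l) * block_diag L1 L2 $$ (l, j))
        + (\<Sum>l<m. append_cols X1 X2 $$ (i, r + l) * block_diag L1 L2 $$ (r + l, j))"
    if "i < n" "j < r + m" for i j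
    using arg_cong[OF eig, of "\<lambda>M. M $$ (i, j)"] carr A B that
    by (simp add: scalar_prod_def lessThan_atLeast0[symmetric] sum_lessThan_add)
  show "A * X1 = X1 * L1"
  proof (rule eq_matI)
    fix i j assume "i < dim_row (X1 * L1)" "j < dim_col (X1 * L1)"
    thus "(A * X1) $$ (i, j) = (X1 * L1) $$ (i, j)"
      using entry[of i j] X L A
      by (simp add: scalar_prod_def lessThan_atLeast0[symmetric] index_append_cols[OF X] B_ix)
  qed (use X L A in auto)
  show "A * X2 = X2 * L2"
  proof (rule eq_matI)
    fix i j assume "i < dim_row (X2 * L2)" "j < dim_col (X2 * L2)"
    thus "(A * X2) $$ (i, j) = (X2 * L2) $$ (i, j)"
      using entry[of i "r + j"] X L A
      by (simp add: scalar_prod_def lessThan_atLeast0[symmetric] index_append_cols[OF X] B_ix)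
  qed (use X L A in auto)
qed

text \<open>Column \<open>j\<close> of \<open>G\<close> collects coefficients that express column
  \<open>j\<close> of \<open>A\<close> through the columns of \<open>B\<close>.\<close>

lemma col_space_subset_factor:
  fixes A :: "complex mat"
  assumes A: "A \<in> carrier_mat n r" and B: "B \<in> carrier_mat n r"
    and sub: "vec_space.col_space n A \<subseteq> vec_space.col_space n B"
  obtains G where "G \<in> carrier_mat r r" "A = B * G"
proof -
  interpret vec_space "TYPE(complex)" n .
  have "\<exists>x \<in> carrier_vec r. B *\<^sub>v x = col A j" if "j < r" for j
  proof -
    have "col A j \<in> set (cols A)" using that A by (auto simp: cols_def)
    moreover have "set (cols A) \<subseteq> col_space A"
      unfolding col_space_def using A cols_dim[of A] by (intro in_own_span) auto
    ultimately have "col A j \<in> col_space B" using sub by blast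
    thus ?thesis using B by (auto simp: col_space_eq[OF B])
  qed
  then obtain x where x: "\<And>j. j < r \<Longrightarrow> x j \<in> carrier_vec r" "\<And>j. j < r \<Longrightarrow> B *\<^sub>v x j = col A j"
    by metis
  define G where "G = mat_of_cols r (map x [0..<r])"
  have G: "G \<in> carrier_mat r r" using mat_of_cols_carrier[of r "map x [0..<r]"] by (simp add: G_def)
  have "A = B * G"
  proof (rule mat_col_eqI)
    fix j assume "j < dim_col (B * G)"
    hence j: "j < r" using G by simp
    have "col G j = x j" using j x(1)[OF j] unfolding G_def by (subst col_mat_of_cols) auto
    thus "col A j = col (B * G) j" using x(2)[OF j] j by (simp add: col_mult2[OF B G])
  qed (use A B G in auto)
  with G show ?thesis by (rule that)
qed

text \<open>Equal column spaces give \<open>Q = X G\<close> and \<open>X = Q H\<close> with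
  \<open>G\<close> and \<open>H\<close> mutually inverse. Hence \<open>A Q = Q B\<close> with
  \<open>B = H L G\<close> similar to \<open>L\<close>, and a unitary Schur form of \<open>B\<close>
  with the diagonal order of \<open>L\<close> supplies \<open>U\<close> and
  \<open>T\<close>.\<close>

lemma invariant_subspace_schur:
  fixes A :: "complex mat"
  assumes A: "A \<in> carrier_mat n n" and X: "X \<in> carrier_mat n r"
    and L: "L \<in> carrier_mat r r" "diagonal_mat L" and AX: "A * X = X * L"
    and Q: "Q \<in> carrier_mat n r" "mat_adjoint Q * Q = 1\<^sub>m r"
    and space: "vec_space.col_space n Q = vec_space.col_space n X"
  obtains U T where "U \<in> carrier_mat r r" "mat_adjoint U * U = 1\<^sub>m r"
    "T \<in> carrier_mat r r" "upper_triangular T" "\<And>j. j < r \<Longrightarrow> T $$ (j, j) = L $$ (j, j)"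
    "A * (Q * U) = Q * U * T"
proof -
  obtain G where G: "G \<in> carrier_mat r r" "Q = X * G"
    using col_space_subset_factor[OF Q(1) X] space by blast
  obtain H where H: "H \<in> carrier_mat r r" "X = Q * H"
    using col_space_subset_factor[OF X Q(1)] space by blast
  have Qc: "mat_adjoint Q \<in> carrier_mat r n" using Q by auto
  \<comment> \<open>Multiplying by the adjoint of \<open>Q\<close>, a left inverse, cancels
    \<open>Q\<close> and leaves \<open>H * G = 1\<close>.\<close>
  have "Q * (H * G) = Q"
    using assoc_mult_mat[OF Q(1) H(1) G(1)] by (simp only: H(2)[symmetric] G(2)[symmetric])
  hence "mat_adjoint Q * Q = mat_adjoint Q * Q * (H * G)"
    using assoc_mult_mat[OF Qc Q(1) mult_carrier_mat[OF H(1) G(1)]] by simp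
  hence HG: "H * G = 1\<^sub>m r"
    using left_mult_one_mat[OF mult_carrier_mat[OF H(1) G(1)]] by (simp add: Q(2))
  have GH: "G * H = 1\<^sub>m r" by (rule mat_mult_left_right_inverse[OF H(1) G(1) HG])
  define B where "B = H * L * G"
  have B: "B \<in> carrier_mat r r" using H(1) L(1) G(1) by (simp add: B_def)
  have "similar_mat B L"
    unfolding similar_mat_def
    by (intro exI, rule similar_mat_witI[of H G r]) (use HG GH H(1) G(1) L B in \<open>auto simp: B_def\<close>)
  hence cp: "char_poly B = (\<Prod>e\<leftarrow>diag_mat L. [:- e, 1:])"
    using char_poly_similar char_poly_upper_triangular[OF L(1) diagonal_imp_upper_triangular[OF L(2,1)]]
    by metis
  have "A * Q = X * L * G"
    using assoc_mult_mat[OF A X G(1)] by (simp only: AX G(2)[symmetric])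
  also have "\<dots> = Q * B"
    unfolding B_def using H(2) assoc_mult_mat[OF Q(1) H(1) L(1)]
      assoc_mult_mat[OF Q(1) mult_carrier_mat[OF H(1) L(1)] G(1)] by simp
  finally have AQ: "A * Q = Q * B" .
  obtain U where U: "U \<in> carrier_mat r r" "mat_adjoint U * U = 1\<^sub>m r"
    and ut: "upper_triangular (mat_adjoint U * B * U)" and diag: "diag_mat (mat_adjoint U * B * U) = diag_mat L"
    using unitary_schur[OF B cp] by blast
  define T where "T = mat_adjoint U * B * U"
  have Uc: "mat_adjoint U \<in> carrier_mat r r" using U by auto
  have UU: "U * mat_adjoint U = 1\<^sub>m r"
    by (rule mat_mult_left_right_inverse[OF Uc U(1) U(2)])
  have T: "T \<in> carrier_mat r r" using U B Uc by (simp add: T_def)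
  have "U * T = U * mat_adjoint U * (B * U)"
    using U B Uc by (simp add: T_def assoc_mult_mat[of _ r r _ r _ r])
  hence UT: "U * T = B * U" using B U by (simp add: UU)
  have "A * (Q * U) = Q * B * U"
    using assoc_mult_mat[OF A Q(1) U(1)] by (simp add: AQ)
  also have "\<dots> = Q * U * T"
    using assoc_mult_mat[OF Q(1) B U(1)] assoc_mult_mat[OF Q(1) U(1) T] by (simp add: UT)
  finally have "A * (Q * U) = Q * U * T" .
  moreover have "T $$ (j, j) = L $$ (j, j)" if "j < r" for j
    using arg_cong[OF diag, of "\<lambda>xs. xs ! j"] that T L by (simp add: diag_mat_def T_def[symmetric])
  ultimately show ?thesis using that[OF U T] ut by (simp add: T_def)
qed

text \<open>The adjoint may have a kernel, so the lower bound is stated on the range of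
  \<open>Z\<close>. For \<open>y = Z c\<close>, combine
  \<open>|y|^2 = <c, Z^* y> \<le> |c| |Z^* y|\<close> with
  \<open>smin |c| \<le> |y|\<close>.\<close>

lemma min_singular_value_le_adjoint:
  assumes Z: "Z \<in> carrier_mat n m" and m: "0 < m" and c: "c \<in> carrier_vec m"
  shows "Min (set (singular_values Z)) * l2_norm (Z *\<^sub>v c) \<le> l2_norm (mat_adjoint Z *\<^sub>v (Z *\<^sub>v c))"
proof (cases "l2_norm (Z *\<^sub>v c) = 0")
  case False
  let ?s = "Min (set (singular_values Z))" and ?y = "Z *\<^sub>v c"
  have y: "?y \<in> carrier_vec n" by (rule mult_mat_vec_carrier[OF Z c])
  have y': "mat_adjoint Z *\<^sub>v ?y \<in> carrier_vec m"
    by (rule mult_mat_vec_carrier[OF mat_adjoint_carrier[OF Z] y])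
  have s: "0 \<le> ?s"
    by (rule singular_values_nonneg[OF Z Min_in[OF finite_set singular_values_nonempty[OF Z m]]])
  have "(l2_norm ?y)\<^sup>2 = cmod (?y \<bullet>c ?y)" by (simp only: cscalar_prod_self norm_of_real) simp
  also have "?y \<bullet>c ?y = c \<bullet>c (mat_adjoint Z *\<^sub>v ?y)" by (rule cscalar_prod_mat_adjoint[OF Z c y])
  also have "cmod \<dots> \<le> l2_norm c * l2_norm (mat_adjoint Z *\<^sub>v ?y)"
    by (rule cmod_cscalar_prod_le[OF c y'])
  finally have "?s * (l2_norm ?y)\<^sup>2 \<le> ?s * l2_norm c * l2_norm (mat_adjoint Z *\<^sub>v ?y)"
    using s by (simp add: mult.assoc mult_left_mono)
  also have "\<dots> \<le> l2_norm ?y * l2_norm (mat_adjoint Z *\<^sub>v ?y)"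
    using min_singular_value_le_l2_norm_mult[OF Z m c] by (simp add: mult_right_mono)
  finally have "l2_norm ?y * (?s * l2_norm ?y) \<le> l2_norm ?y * l2_norm (mat_adjoint Z *\<^sub>v ?y)"
    by (simp add: power2_eq_square mult_ac)
  moreover have "0 < l2_norm ?y" using False by (simp add: order_less_le)
  ultimately show ?thesis by simp
qed simp

text \<open>A zero singular value would have a unit vector in the kernel of \<open>Z\<close>,
  contradicting the left inverse \<open>Y\<close>.\<close>

lemma min_singular_value_pos:
  assumes Z: "Z \<in> carrier_mat n m" and m: "0 < m"
    and Y: "Y \<in> carrier_mat m n" "Y * Z = 1\<^sub>m m"
  shows "0 < Min (set (singular_values Z))"
proof -
  let ?s = "Min (set (singular_values Z))"
  have s: "?s \<in> set (singular_values Z)" using singular_values_nonempty[OF Z m] by auto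
  then obtain v where v: "v \<in> carrier_vec m" "l2_norm v = 1" "l2_norm (Z *\<^sub>v v) = ?s"
    using singular_value_vector[OF Z] by metis
  have "?s \<noteq> 0"
  proof
    assume "?s = 0"
    hence "Z *\<^sub>v v = 0\<^sub>v n"
      using v(3) l2_norm_eq_0_iff[OF mult_mat_vec_carrier[OF Z v(1)]] by simp
    hence "1\<^sub>m m *\<^sub>v v = Y *\<^sub>v 0\<^sub>v n"
      using assoc_mult_mat_vec[OF Y(1) Z v(1)] by (simp add: Y(2))
    also have "Y *\<^sub>v 0\<^sub>v n = 0\<^sub>v m" using Y(1) by (intro eq_vecI) auto
    finally have "v = 0\<^sub>v m" using v(1) by simp
    thus False using v(2) l2_norm_eq_0_iff[OF v(1)] by simp
  qed
  thus ?thesis using singular_values_nonneg[OF Z s] by simp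
qed

theorem theorem3p1:
  fixes n r :: nat
    and A \<Delta>A At X X1 X2 Xt Xt1 Xt2 \<Lambda>1 \<Lambda>2 \<Lambda>t1 \<Lambda>t2 Xinv V1 V2 Q Qt :: "complex mat"
    and a \<delta> :: real
  assumes n: "2 \<le> n" and r: "1 \<le> r" "r \<le> n - 1"
    and A: "A \<in> carrier_mat n n" and \<Delta>A: "\<Delta>A \<in> carrier_mat n n"
    and At: "At = A + \<Delta>A"
    and X1: "X1 \<in> carrier_mat n r" and X2: "X2 \<in> carrier_mat n (n - r)"
    and Xt1: "Xt1 \<in> carrier_mat n r" and Xt2: "Xt2 \<in> carrier_mat n (n - r)"
    and \<Lambda>1: "\<Lambda>1 \<in> carrier_mat r r" "diagonal_mat \<Lambda>1"
    and \<Lambda>2: "\<Lambda>2 \<in> carrier_mat (n - r) (n - r)" "diagonal_mat \<Lambda>2"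
    and \<Lambda>t1: "\<Lambda>t1 \<in> carrier_mat r r" "diagonal_mat \<Lambda>t1"
    and \<Lambda>t2: "\<Lambda>t2 \<in> carrier_mat (n - r) (n - r)" "diagonal_mat \<Lambda>t2"
    and X: "X = append_cols X1 X2" and Xt: "Xt = append_cols Xt1 Xt2"
    and X_invertible: "invertible_mat X" and Xt_invertible: "invertible_mat Xt"
    and X_unit: "\<And>j. j < n \<Longrightarrow> l2_norm (col X j) = 1"
    and eig: "A * X = X * block_diag \<Lambda>1 \<Lambda>2"
    and eigt: "At * Xt = Xt * block_diag \<Lambda>t1 \<Lambda>t2"
    and \<delta>: "\<delta> = Min {cmod (l - s) | l s. l \<in> spectrum \<Lambda>t1 \<and> s \<in> spectrum \<Lambda>2}"
    and \<delta>_pos: "\<delta> > 0"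
    and Xinv: "Xinv \<in> carrier_mat n n" "inverts_mat X Xinv" "inverts_mat Xinv X"
    and V1: "V1 \<in> carrier_mat n r" and V2: "V2 \<in> carrier_mat n (n - r)"
    and V: "mat_adjoint Xinv = append_cols V1 V2"
    and a: "a = spectral_norm A + spectral_norm \<Delta>A + spectral_radius \<Lambda>2"
    and Q: "Q \<in> carrier_mat n r" "orthonormal_cols Q"
      "vec_space.col_space n Q = vec_space.col_space n X1"
    and Qt: "Qt \<in> carrier_mat n r" "orthonormal_cols Qt"
      "vec_space.col_space n Qt = vec_space.col_space n Xt1"
  shows "spectral_norm (sin_Theta Q Qt)
      \<le> kappa2 V2 * frobenius_norm \<Delta>A / a
          * (\<Prod>j<r. 1 + a / Min {cmod (\<Lambda>t1 $$ (j, j) - l) | l. l \<in> spectrum \<Lambda>2})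
    \<and> kappa2 V2 * frobenius_norm \<Delta>A / a
          * (\<Prod>j<r. 1 + a / Min {cmod (\<Lambda>t1 $$ (j, j) - l) | l. l \<in> spectrum \<Lambda>2})
      \<le> kappa2 V2 * frobenius_norm \<Delta>A / a * (\<Prod>j<r. 1 + a / \<delta>)"
proof -

  \<comment> \<open>Dual bases and the splitting of the identity\<close>
  define m where "m = n - r"
  have dims: "0 < r" "0 < m" "n = r + m" "0 < n" using n r by (auto simp: m_def)
  note X2 = X2[folded m_def] and V2 = V2[folded m_def] and \<Lambda>2 = \<Lambda>2[folded m_def]
    and Xt2 = Xt2[folded m_def] and \<Lambda>t2 = \<Lambda>t2[folded m_def]
  have At_c: "At \<in> carrier_mat n n" using A \<Delta>A by (simp add: At)
  have X_c: "X \<in> carrier_mat n n" using append_cols_carrier[OF X1 X2] dims by (simp add: X)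
  have Xinv_eq: "Xinv = mat_adjoint (append_cols V1 V2)"
    using V by (metis mat_adjoint_adjoint)
  have inv1: "Xinv * X = 1\<^sub>m n" and inv2: "X * Xinv = 1\<^sub>m n"
    using Xinv X_c by (auto simp: inverts_mat_def)
  have V2c: "mat_adjoint V2 \<in> carrier_mat m n" and V1c: "mat_adjoint V1 \<in> carrier_mat r n"
    and X1c: "mat_adjoint X1 \<in> carrier_mat r n" and X2c: "mat_adjoint X2 \<in> carrier_mat m n"
    using V2 V1 X1 X2 by auto
  note duals = inv1[unfolded Xinv_eq X]
  have VX1: "mat_adjoint V2 * X1 = 0\<^sub>m m r" by (rule dual_blocks_orthogonal[OF X1 X2 dims(3) V1 V2 duals])
  have VX2: "mat_adjoint V2 * X2 = 1\<^sub>m m" by (rule dual_blocks_inverse[OF X1 X2 dims(3) V1 V2 duals])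
  have XV: "X1 * mat_adjoint V1 + X2 * mat_adjoint V2 = 1\<^sub>m n"
    using append_cols_mult_adjoint[OF X1 X2 V1 V2] inv2 by (simp add: Xinv_eq X)
  \<comment> \<open>The adjoint splitting \<open>VX\<close> later shows that vectors orthogonal to
    the columns of \<open>X1\<close> lie in the range of \<open>V2\<close>.\<close>
  have "mat_adjoint Xinv * mat_adjoint X = 1\<^sub>m n"
    using mat_adjoint_mult[OF X_c Xinv(1)] inv2 by simp
  hence VX: "V1 * mat_adjoint X1 + V2 * mat_adjoint X2 = 1\<^sub>m n"
    using append_cols_mult_adjoint[OF V1 V2 X1 X2] by (simp add: V X)
  have XV2: "mat_adjoint X2 * V2 = 1\<^sub>m m"
    using mat_adjoint_mult[OF V2c X2] by (simp add: VX2)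

  \<comment> \<open>Extreme singular values of \<open>V2\<close>\<close>
  define smin where "smin = Min (set (singular_values V2))"
  define smax where "smax = spectral_norm V2"
  have smin: "0 < smin"
    unfolding smin_def by (rule min_singular_value_pos[OF V2 dims(2) X2c XV2])
  have smax: "0 \<le> smax" unfolding smax_def by (rule spectral_norm_nonneg[OF V2 dims(2)])
  have kappa: "kappa2 V2 = smax / smin" by (simp add: kappa2_def smax_def smin_def spectral_norm_def)

  \<comment> \<open>Left eigenvectors of \<open>A\<close>\<close>
  have left_eig: "mat_adjoint V2 * A = \<Lambda>2 * mat_adjoint V2"
  proof -
    have AX: "A * X1 = X1 * \<Lambda>1" "A * X2 = X2 * \<Lambda>2"
      using eigenblock_left[OF A X1 X2 \<Lambda>1(1) \<Lambda>2(1)] eigenblock_right[OF A X1 X2 \<Lambda>1(1) \<Lambda>2(1)] eig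
      by (auto simp: X)
    \<comment> \<open>The product is evaluated on the two oblique projections from
      \<open>XV\<close>: the first contributes zero by \<open>VX1\<close>, the second reproduces the
      eigenvalues by \<open>VX2\<close>.\<close>
    have VA: "mat_adjoint V2 * A \<in> carrier_mat m n" using V2c A by (rule mult_carrier_mat)
    have c1: "X1 * mat_adjoint V1 \<in> carrier_mat n n" using X1 V1c by (rule mult_carrier_mat)
    have c2: "X2 * mat_adjoint V2 \<in> carrier_mat n n" using X2 V2c by (rule mult_carrier_mat)
    have "mat_adjoint V2 * A * (X1 * mat_adjoint V1) = 0\<^sub>m m n"
    proof -
      have "mat_adjoint V2 * A * (X1 * mat_adjoint V1) = mat_adjoint V2 * (A * X1) * mat_adjoint V1"
        using assoc_mult_mat[OF VA X1 V1c] assoc_mult_mat[OF V2c A X1] by simp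
      also have "mat_adjoint V2 * (A * X1) = mat_adjoint V2 * X1 * \<Lambda>1"
        using assoc_mult_mat[OF V2c X1 \<Lambda>1(1)] AX by simp
      finally show ?thesis using VX1 \<Lambda>1 left_mult_zero_mat[OF V1c] by simp
    qed
    moreover have "mat_adjoint V2 * A * (X2 * mat_adjoint V2) = \<Lambda>2 * mat_adjoint V2"
    proof -
      have "mat_adjoint V2 * A * (X2 * mat_adjoint V2) = mat_adjoint V2 * (A * X2) * mat_adjoint V2"
        using assoc_mult_mat[OF VA X2 V2c] assoc_mult_mat[OF V2c A X2] by simp
      also have "mat_adjoint V2 * (A * X2) = mat_adjoint V2 * X2 * \<Lambda>2"
        using assoc_mult_mat[OF V2c X2 \<Lambda>2(1)] AX by simp
      finally show ?thesis using VX2 \<Lambda>2 by simp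
    qed
    moreover have "mat_adjoint V2 * A = mat_adjoint V2 * A * (X1 * mat_adjoint V1 + X2 * mat_adjoint V2)"
      unfolding XV by (rule right_mult_one_mat[OF VA, symmetric])
    ultimately show ?thesis
      using mult_add_distrib_mat[OF VA c1 c2] mult_carrier_mat[OF \<Lambda>2(1) V2c] by simp
  qed

  \<comment> \<open>Orthonormal Schur basis of the perturbed invariant subspace\<close>
  have Q1: "mat_adjoint Q * Q = 1\<^sub>m r" and Qt1: "mat_adjoint Qt * Qt = 1\<^sub>m r"
    using Q Qt by (auto simp: orthonormal_cols_def)
  have AXt: "At * Xt1 = Xt1 * \<Lambda>t1"
    using eigenblock_left[OF At_c Xt1 Xt2 \<Lambda>t1(1) \<Lambda>t2(1)] eigt by (simp add: Xt)
  obtain U T where U: "U \<in> carrier_mat r r" "mat_adjoint U * U = 1\<^sub>m r"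
    and T: "T \<in> carrier_mat r r" "upper_triangular T" "\<And>j. j < r \<Longrightarrow> T $$ (j, j) = \<Lambda>t1 $$ (j, j)"
    and AQT: "At * (Qt * U) = Qt * U * T"
    using invariant_subspace_schur[OF At_c Xt1 \<Lambda>t1 AXt Qt(1) Qt1 Qt(3)] by blast
  define P where "P = Qt * U"
  have P: "P \<in> carrier_mat n r" using Qt(1) U(1) by (simp add: P_def)
  have Pc: "mat_adjoint P \<in> carrier_mat r n" using P by auto
  have Uc: "mat_adjoint U \<in> carrier_mat r r" using U by auto
  have UU: "U * mat_adjoint U = 1\<^sub>m r" by (rule mat_mult_left_right_inverse[OF Uc U(1) U(2)])
  have P1: "mat_adjoint P * P = 1\<^sub>m r"
  proof -
    have Qtc: "mat_adjoint Qt \<in> carrier_mat r n" using Qt by auto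
    have "mat_adjoint P * P = mat_adjoint U * (mat_adjoint Qt * (Qt * U))"
      unfolding P_def mat_adjoint_mult[OF Qt(1) U(1)]
      by (rule assoc_mult_mat[OF Uc Qtc P[unfolded P_def]])
    also have "mat_adjoint Qt * (Qt * U) = U"
      using assoc_mult_mat[OF Qtc Qt(1) U(1)] Qt1 U(1) by simp
    finally show ?thesis by (simp add: U(2))
  qed
  have AP: "At * P = P * T" using AQT by (simp add: P_def)
  have colP: "col P j \<in> carrier_vec n" "l2_norm (col P j) = 1" if "j < r" for j
  proof -
    have "col P j = P *\<^sub>v unit_vec r j"
      using col_mult2[OF P one_carrier_mat that] P that by simp
    thus "l2_norm (col P j) = 1" using l2_norm_orthonormal_mult[OF P P1] that by simp
  qed (use P in auto)

  \<comment> \<open>Column bounds for the triangular factor\<close>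
  define b where "b = spectral_norm A + spectral_norm \<Delta>A"
  \<comment> \<open>The bound by \<open>b\<close>, without the spectral radius, is used again in the
    proof that \<open>a\<close> is positive.\<close>
  have colT: "l2_norm (col T j) \<le> b" if j: "j < r" for j
  proof -
    note p = colP[OF j]
    have Ap: "A *\<^sub>v col P j \<in> carrier_vec n" and Dp: "\<Delta>A *\<^sub>v col P j \<in> carrier_vec n"
      using A \<Delta>A p by (auto intro: mult_mat_vec_carrier)
    \<comment> \<open>As a compression of \<open>At\<close>, the matrix \<open>T\<close> has columns
      obtained by applying a contraction to \<open>At\<close> times a unit vector.\<close>
    have "T = mat_adjoint P * (At * P)"
      using assoc_mult_mat[OF Pc P T(1)] T(1) by (simp add: AP P1)
    hence "col T j = mat_adjoint P *\<^sub>v (At *\<^sub>v col P j)"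
      using col_mult2[OF Pc mult_carrier_mat[OF At_c P] j] col_mult2[OF At_c P j] by simp
    also have "At *\<^sub>v col P j = A *\<^sub>v col P j + \<Delta>A *\<^sub>v col P j"
      unfolding At by (rule add_mult_distrib_mat_vec[OF A \<Delta>A p(1)])
    finally have "l2_norm (col T j) \<le> l2_norm (A *\<^sub>v col P j + \<Delta>A *\<^sub>v col P j)"
      using l2_norm_adjoint_orthonormal_le[OF P P1 add_carrier_vec[OF Ap Dp]] by simp
    also have "\<dots> \<le> l2_norm (A *\<^sub>v col P j) + l2_norm (\<Delta>A *\<^sub>v col P j)"
      by (rule l2_norm_add_le[OF Ap Dp])
    also have "\<dots> \<le> b"
      using l2_norm_mult_le_spectral_norm[OF A dims(4) p(1)]
        l2_norm_mult_le_spectral_norm[OF \<Delta>A dims(4) p(1)] by (simp add: p(2) b_def)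
    finally show ?thesis .
  qed

  \<comment> \<open>Spectral gaps and positivity of \<open>a\<close>\<close>
  define g where "g j = Min {cmod (\<Lambda>t1 $$ (j, j) - l) | l. l \<in> spectrum \<Lambda>2}" for j
  have spec2: "finite (spectrum \<Lambda>2)" "spectrum \<Lambda>2 \<noteq> {}"
    using card_finite_spectrum[OF \<Lambda>2(1)] spectrum_non_empty[OF \<Lambda>2(1) dims(2)] by auto
  have g_img: "g j = Min ((\<lambda>l. cmod (\<Lambda>t1 $$ (j, j) - l)) ` spectrum \<Lambda>2)" for j
    by (simp add: g_def Setcompr_eq_image)
  have g_le: "g j \<le> cmod (\<Lambda>t1 $$ (j, j) - l)" if "l \<in> spectrum \<Lambda>2" for j l
    unfolding g_img using spec2 that by (intro Min_le) auto
  \<comment> \<open>The minimum \<open>g j\<close> is attained, and it is one of the distances over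
    which \<delta> is minimised because diagonal entries are eigenvalues.\<close>
  have \<delta>_le: "\<delta> \<le> g j" if j: "j < r" for j
  proof -
    have "g j \<in> (\<lambda>l. cmod (\<Lambda>t1 $$ (j, j) - l)) ` spectrum \<Lambda>2"
      unfolding g_img using spec2 by (intro Min_in) auto
    hence "g j \<in> (\<lambda>(l, s). cmod (l - s)) ` (spectrum \<Lambda>t1 \<times> spectrum \<Lambda>2)"
      using diagonal_entry_in_spectrum[OF \<Lambda>t1 j] by auto
    moreover have "\<delta> = Min ((\<lambda>(l, s). cmod (l - s)) ` (spectrum \<Lambda>t1 \<times> spectrum \<Lambda>2))"
      unfolding \<delta> by (rule arg_cong[of _ _ Min]) auto
    ultimately show ?thesis
      using spec2 card_finite_spectrum[OF \<Lambda>t1(1)] by (auto intro!: Min_le)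
  qed
  have g_pos: "0 < g j" if "j < r" for j using \<delta>_le[OF that] \<delta>_pos by linarith

  obtain l0 where l0: "l0 \<in> spectrum \<Lambda>2" using spec2 by auto
  have rho: "cmod l0 \<le> spectral_radius \<Lambda>2"
    using l0 spectral_radius_mem_max(2)[OF \<Lambda>2(1) dims(2)] by auto
  have b_le: "b \<le> a" using order_trans[OF norm_ge_zero rho] by (simp add: a b_def)
  \<comment> \<open>The gap forces positivity: \<open>0 < g 0\<close>, while \<open>g 0\<close> is
    at most the modulus of the first diagonal entry of \<open>T\<close> plus that of
    \<open>l0\<close>, hence at most \<open>b\<close> plus the spectral radius.\<close>
  have a_pos: "0 < a"
  proof -
    have "cmod (\<Lambda>t1 $$ (0, 0)) \<le> l2_norm (col T 0)"
      using member_le_L2_set[of "{..<r}" 0 "\<lambda>i. cmod (col T 0 $ i)"] T dims by (simp add: l2_norm_L2_set)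
    hence "cmod (\<Lambda>t1 $$ (0, 0)) \<le> b" using colT[OF dims(1)] by simp
    hence "g 0 \<le> b + cmod l0"
      using g_le[OF l0, of 0] norm_triangle_ineq4[of "\<Lambda>t1 $$ (0, 0)" l0] by linarith
    thus ?thesis using g_pos[OF dims(1)] rho by (simp add: a b_def)
  qed

  \<comment> \<open>The Sylvester equation for \<open>W\<close>\<close>
  define E where "E = smax * frobenius_norm \<Delta>A"
  have E: "0 \<le> E" using smax by (simp add: E_def frobenius_norm_def sum_nonneg)
  define W where "W = mat_adjoint V2 * P"
  define N where "N = mat_adjoint V2 * (\<Delta>A * P)"
  have DP: "\<Delta>A * P \<in> carrier_mat n r" and AP_c: "A * P \<in> carrier_mat n r"
    using \<Delta>A A P by (auto intro: mult_carrier_mat)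
  have W: "W \<in> carrier_mat m r" unfolding W_def by (rule mult_carrier_mat[OF V2c P])
  have N: "N \<in> carrier_mat m r" unfolding N_def by (rule mult_carrier_mat[OF V2c DP])
  \<comment> \<open>The product of the adjoint of \<open>V2\<close> with \<open>At * P\<close> is
    computed twice: through \<open>AP\<close>, and by splitting \<open>At\<close> and using the left
    eigenvectors.\<close>
  have syl: "W * T = \<Lambda>2 * W + N"
  proof -
    have "W * T = mat_adjoint V2 * (At * P)"
      unfolding W_def AP by (rule assoc_mult_mat[OF V2c P T(1)])
    also have "At * P = A * P + \<Delta>A * P"
      unfolding At by (rule add_mult_distrib_mat[OF A \<Delta>A P])
    also have "mat_adjoint V2 * \<dots> = mat_adjoint V2 * (A * P) + N"
      unfolding N_def by (rule mult_add_distrib_mat[OF V2c AP_c DP])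
    also have "mat_adjoint V2 * (A * P) = \<Lambda>2 * W"
      unfolding W_def using assoc_mult_mat[OF V2c A P] assoc_mult_mat[OF \<Lambda>2(1) V2c P] left_eig by simp
    finally show ?thesis .
  qed
  have colN: "l2_norm (col N j) \<le> E" if j: "j < r" for j
  proof -
    note p = colP[OF j]
    have "col N j = mat_adjoint V2 *\<^sub>v (\<Delta>A *\<^sub>v col P j)"
      unfolding N_def using col_mult2[OF V2c DP j] col_mult2[OF \<Delta>A P j] by simp
    also have "l2_norm \<dots> \<le> smax * l2_norm (\<Delta>A *\<^sub>v col P j)"
      using l2_norm_mult_le_spectral_norm[OF V2 dims(2)]
      by (intro l2_norm_mat_adjoint_le[OF V2 smax]) (auto simp: smax_def intro: mult_mat_vec_carrier[OF \<Delta>A p(1)])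
    also have "\<dots> \<le> E"
      unfolding E_def using smax l2_norm_mult_frobenius_le[OF \<Delta>A p(1)] p(2) by (intro mult_left_mono) auto
    finally show ?thesis .
  qed
  have "frobenius_norm W + E / a \<le> E / a * (\<Prod>j<r. 1 + a / g j)"
  proof (rule frobenius_norm_sylvester_triangular[OF W T(1,2) \<Lambda>2 N syl colN _ a_pos g_pos])
    show "l2_norm (col T j) \<le> a" if "j < r" for j using colT[OF that] b_le by simp
    show "g j \<le> cmod (T $$ (j, j) - \<Lambda>2 $$ (k, k))" if "j < r" "k < m" for j k
      using g_le[OF diagonal_entry_in_spectrum[OF \<Lambda>2 that(2)]] T(3)[OF that(1)] by simp
  qed
  moreover have "0 \<le> E / a" using E a_pos by simp
  ultimately have W_le: "frobenius_norm W \<le> E / a * (\<Prod>j<r. 1 + a / g j)" by linarith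

  \<comment> \<open>From \<open>W\<close> to the sines\<close>
  have "spectral_norm (sin_Theta Q Qt) \<le> frobenius_norm W / smin"
  proof (rule spectral_norm_sin_Theta_le[OF Q(1) Q1 Qt(1) Qt1 dims(1)])
    fix v :: "complex vec" assume v: "v \<in> carrier_vec r" "l2_norm v = 1"
    define x where "x = Qt *\<^sub>v v"
    define w where "w = mat_adjoint Q *\<^sub>v x"
    \<comment> \<open>The component of \<open>Qt v\<close> orthogonal to the column space of
      \<open>Q\<close>; its length is what has to be bounded.\<close>
    define y where "y = x - Q *\<^sub>v w"
    have Qc: "mat_adjoint Q \<in> carrier_mat r n" using Q by auto
    have x: "x \<in> carrier_vec n" unfolding x_def by (rule mult_mat_vec_carrier[OF Qt(1) v(1)])
    have w: "w \<in> carrier_vec r" unfolding w_def by (rule mult_mat_vec_carrier[OF Qc x])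
    have Qw: "Q *\<^sub>v w \<in> carrier_vec n" by (rule mult_mat_vec_carrier[OF Q(1) w])
    have y: "y \<in> carrier_vec n" using x Qw by (simp add: y_def)
    have Qy: "mat_adjoint Q *\<^sub>v y = 0\<^sub>v r"
      unfolding y_def w_def by (rule l2_norm_projection_complement(1)[OF Q(1) Q1 x])
    obtain H where H: "H \<in> carrier_mat r r" "X1 = Q * H"
      using col_space_subset_factor[OF X1 Q(1)] Q(3) by blast
    obtain G where G: "G \<in> carrier_mat r r" "Q = X1 * G"
      using col_space_subset_factor[OF Q(1) X1] Q(3) by blast
    have X1y: "mat_adjoint X1 *\<^sub>v y = 0\<^sub>v r"
      unfolding H(2) mat_adjoint_mult[OF Q(1) H(1)]
      using assoc_mult_mat_vec[OF mat_adjoint_carrier[OF H(1)] Qc y] Qy H(1)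
      by (auto intro!: eq_vecI)
    define c where "c = mat_adjoint X2 *\<^sub>v y"
    have c: "c \<in> carrier_vec m" unfolding c_def by (rule mult_mat_vec_carrier[OF X2c y])
    \<comment> \<open>In the splitting \<open>VX\<close> the first term vanishes on
      \<open>y\<close>, which places \<open>y\<close> in the range of \<open>V2\<close>.\<close>
    have "1\<^sub>m n *\<^sub>v y = V1 *\<^sub>v (mat_adjoint X1 *\<^sub>v y) + V2 *\<^sub>v c"
      unfolding VX[symmetric] c_def
      using add_mult_distrib_mat_vec[OF mult_carrier_mat[OF V1 X1c] mult_carrier_mat[OF V2 X2c] y]
        assoc_mult_mat_vec[OF V1 X1c y] assoc_mult_mat_vec[OF V2 X2c y] by simp
    also have "V1 *\<^sub>v (mat_adjoint X1 *\<^sub>v y) = 0\<^sub>v n"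
      unfolding X1y using V1 by (intro eq_vecI) auto
    finally have yc: "y = V2 *\<^sub>v c" using y mult_mat_vec_carrier[OF V2 c] by simp
    \<comment> \<open>The columns of \<open>V2\<close> are orthogonal to the column space of
      \<open>Q\<close>, so removing the projection from \<open>x\<close> does not change its image
      under the adjoint of \<open>V2\<close>.\<close>
    have "mat_adjoint V2 * Q = 0\<^sub>m m r"
      unfolding G(2) using assoc_mult_mat[OF V2c X1 G(1)] VX1 G(1) by simp
    moreover have "0\<^sub>m m r *\<^sub>v w = 0\<^sub>v m" using w by (intro eq_vecI) auto
    ultimately have "mat_adjoint V2 *\<^sub>v (Q *\<^sub>v w) = 0\<^sub>v m"
      using assoc_mult_mat_vec[OF V2c Q(1) w] by simp
    hence "mat_adjoint V2 *\<^sub>v y = mat_adjoint V2 *\<^sub>v x"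
      unfolding y_def mult_minus_distrib_mat_vec[OF V2c x Qw]
      using mult_mat_vec_carrier[OF V2c x] by simp
    \<comment> \<open>Since \<open>U\<close> is unitary, \<open>x = Qt v\<close> has coordinates
      \<open>U^* v\<close> in the basis \<open>P\<close>.\<close>
    also have "\<dots> = W *\<^sub>v (mat_adjoint U *\<^sub>v v)"
    proof -
      have u: "mat_adjoint U *\<^sub>v v \<in> carrier_vec r" by (rule mult_mat_vec_carrier[OF Uc v(1)])
      have "P *\<^sub>v (mat_adjoint U *\<^sub>v v) = Qt *\<^sub>v (U *\<^sub>v (mat_adjoint U *\<^sub>v v))"
        unfolding P_def by (rule assoc_mult_mat_vec[OF Qt(1) U(1) u])
      also have "U *\<^sub>v (mat_adjoint U *\<^sub>v v) = v"
        using assoc_mult_mat_vec[OF U(1) Uc v(1)] UU v(1) by simp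
      finally show ?thesis
        unfolding W_def x_def using assoc_mult_mat_vec[OF V2c P u] by simp
    qed
    finally have V2y: "mat_adjoint V2 *\<^sub>v y = W *\<^sub>v (mat_adjoint U *\<^sub>v v)" .
    have "l2_norm (mat_adjoint U *\<^sub>v v) = 1"
      using l2_norm_orthonormal_mult[OF Uc _ v(1)] UU v(2) by simp
    hence "l2_norm (mat_adjoint V2 *\<^sub>v y) \<le> frobenius_norm W"
      unfolding V2y using l2_norm_mult_frobenius_le[OF W mult_mat_vec_carrier[OF Uc v(1)]] by simp
    moreover have "smin * l2_norm y \<le> l2_norm (mat_adjoint V2 *\<^sub>v y)"
      unfolding smin_def yc by (rule min_singular_value_le_adjoint[OF V2 dims(2) c])
    ultimately have "l2_norm y \<le> frobenius_norm W / smin"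
      using smin by (simp add: pos_le_divide_eq mult.commute)
    thus "l2_norm (Qt *\<^sub>v v - Q *\<^sub>v (mat_adjoint Q *\<^sub>v (Qt *\<^sub>v v))) \<le> frobenius_norm W / smin"
      by (simp add: y_def w_def x_def)
  qed
  also have "\<dots> \<le> E / a * (\<Prod>j<r. 1 + a / g j) / smin"
    by (rule divide_right_mono[OF W_le less_imp_le[OF smin]])
  also have "\<dots> = kappa2 V2 * frobenius_norm \<Delta>A / a * (\<Prod>j<r. 1 + a / g j)"
    by (simp add: kappa E_def)
  finally have first: "spectral_norm (sin_Theta Q Qt)
      \<le> kappa2 V2 * frobenius_norm \<Delta>A / a * (\<Prod>j<r. 1 + a / g j)" .

  \<comment> \<open>Replacing the individual gaps by the smallest one\<close>
  have "(\<Prod>j<r. 1 + a / g j) \<le> (\<Prod>j<r. 1 + a / \<delta>)"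
    using \<delta>_le g_pos \<delta>_pos a_pos
    by (intro prod_mono) (auto intro!: add_nonneg_nonneg divide_left_mono simp: less_imp_le)
  moreover have "0 \<le> kappa2 V2 * frobenius_norm \<Delta>A / a"
    using smin smax a_pos by (simp add: kappa frobenius_norm_def sum_nonneg)
  ultimately have "kappa2 V2 * frobenius_norm \<Delta>A / a * (\<Prod>j<r. 1 + a / g j)
      \<le> kappa2 V2 * frobenius_norm \<Delta>A / a * (\<Prod>j<r. 1 + a / \<delta>)"
    by (rule mult_left_mono)
  with first show ?thesis unfolding g_def by blast
qed

end
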